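(* Let $\mu,\nu\in\mathcal P(\mathbb R)$ with $\mu\le_{\rm cx}\nu$, and let $\pi_{\rm lc}\in\mathcal M(\mu,\nu)$ be the left-curtain transport. There exists a Borel function $h:\mathbb R\to\mathbb R$ such that $\pi_{\rm lc}(S_{\rm rg}\cup S_{\rm diag}\cup S_{\rm atom})=1$, where (i) $S_{\rm rg}=\{(h(y),y):y\in\mathbb R\}$; (ii) $S_{\rm diag}=\{(x,x):x\in\mathbb R\}$; (iii) $S_{\rm atom}=\{(x,y)\in\mathbb R^2:\nu(\{y\})>0\}$. If moreover $\frac{d\mu}{d(\mu+\nu)}\ge\frac12$ $\mu$-a.e., then $\pi_{\rm lc}(S_{\rm rg}\cup S_{\rm atom})=1$ for some Borel $h$ (with $S_{\rm rg}$ defined from this $h$ as in (i)). In particular, if in addition (to this density condition) $\nu$ is atomless, then $\pi_{\rm lc}\in\mathcal M_M(\mu,\nu)$.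
   Context: $\mathcal P(\mathbb R)$ is the set of Borel probability measures on $\mathbb R$ with finite first moment. For finite measures with finite first moment, $\mu\le_{\rm cx}\nu$ means $\int\phi\,d\mu\le\int\phi\,d\nu$ for every convex $\phi:\mathbb R\to\mathbb R$ (this forces equal mass and mean), and $\mu\le_{\rm E}\nu$ means the same inequality for every nonnegative convex $\phi$. $\mathcal M(\mu,\nu)$ is the set of martingale transports: laws of $(X,Y)$ with $X\sim\mu$, $Y\sim\nu$, $\mathbb E[Y|X]=X$ a.s. $\mathcal M_M(\mu,\nu)$ is the subset of those $\pi$ of the form $\pi=(f,\mathrm{id}_{\mathbb R})_{\#}\nu$ with $f:\mathbb R\to\mathbb R$ Borel. Shadow: for finite measures $\mu\le_{\rm E}\nu$ with finite first moment, the shadow of $\mu$ in $\nu$ is $S^\nu(\mu)=\min\{\eta:\mu\le_{\rm cx}\eta\le\nu\}$, where $\eta\le\nu$ is set-wise and the minimum is with respect to the partial order $\le_{\rm cx}$ (it is known that this minimum exists). Left-curtain transport: for $\mu\le_{\rm cx}\nu$, $\pi_{\rm lc}$ is the unique element of $\mathcal M(\mu,\nu)$ that transports $\mu|_{(-\infty,x]}$ to its shadow $S^\nu(\mu|_{(-\infty,x]})$ for every $x\in\mathbb R$, i.e. the second marginal of $\pi_{\rm lc}|_{(-\infty,x]\times\mathbb R}$ equals $S^\nu(\mu|_{(-\infty,x]})$ (existence and uniqueness are known). *)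

theory Defs
  imports "HOL-Probability.Probability"
begin

definition finite_moment_measures :: "real measure set" where
  "finite_moment_measures =
     {M. sets M = sets borel \<and> finite_measure M \<and> integrable M (\<lambda>x. x)}"

definition prob_finite_moment :: "real measure set" where
  "prob_finite_moment =
     {M. sets M = sets borel \<and> prob_space M \<and> integrable M (\<lambda>x. x)}"

text \<open>
  A convex function is bounded below by an affine one, so its integral against a finite measure
  with finite first moment exists in the extended reals, but it may be infinite. It is
  therefore taken as the integral of the positive part minus that of the negative part
  (\<^const>\<open>ennreal\<close> truncates negative reals to 0); the Bochner integral would return 0 in the
  infinite case.
\<close>

definition ext_integral :: "real measure \<Rightarrow> (real \<Rightarrow> real) \<Rightarrow> ereal" where
  "ext_integral M \<phi> =
     enn2ereal (\<integral>\<^sup>+x. ennreal (\<phi> x) \<partial>M) - enn2ereal (\<integral>\<^sup>+x. ennreal (- \<phi> x) \<partial>M)"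

definition le_cx :: "real measure \<Rightarrow> real measure \<Rightarrow> bool" (infix "\<le>cx" 50) where
  "M \<le>cx N \<longleftrightarrow> (\<forall>\<phi>. convex_on UNIV \<phi> \<longrightarrow> ext_integral M \<phi> \<le> ext_integral N \<phi>)"

definition le_E :: "real measure \<Rightarrow> real measure \<Rightarrow> bool" (infix "\<le>E" 50) where
  "M \<le>E N \<longleftrightarrow>
     (\<forall>\<phi>. convex_on UNIV \<phi> \<and> (\<forall>x. 0 \<le> \<phi> x) \<longrightarrow> ext_integral M \<phi> \<le> ext_integral N \<phi>)"

text \<open>Unlike \<^const>\<open>restrict_space\<close>, this keeps the underlying space.\<close>

definition restr_measure :: "'a measure \<Rightarrow> 'a set \<Rightarrow> 'a measure" where
  "restr_measure M A = density M (indicator A)"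

definition martingale_transports :: "real measure \<Rightarrow> real measure \<Rightarrow> (real \<times> real) measure set" where
  "martingale_transports \<mu> \<nu> =
     {\<pi>. sets \<pi> = sets borel \<and> distr \<pi> borel fst = \<mu> \<and> distr \<pi> borel snd = \<nu> \<and>
         (AE z in \<pi>. real_cond_exp \<pi> (vimage_algebra (space \<pi>) fst borel) snd z = fst z)}"

definition monge_martingale_transports ::
    "real measure \<Rightarrow> real measure \<Rightarrow> (real \<times> real) measure set" where
  "monge_martingale_transports \<mu> \<nu> =
     {\<pi> \<in> martingale_transports \<mu> \<nu>.
        \<exists>f \<in> borel_measurable borel. \<pi> = distr \<nu> borel (\<lambda>y. (f y, y))}"

text \<open>
  \<open>is_shadow \<nu> \<mu> \<eta>\<close> says that \<open>\<eta>\<close> is the shadow of \<open>\<mu>\<close> in \<open>\<nu>\<close>, i.e. the least element of the set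
  of competitors with respect to the convex order. For measures with the same measurable sets,
  \<open>\<eta> \<le> \<nu>\<close> is the set-wise order.
\<close>

definition shadow_competitors :: "real measure \<Rightarrow> real measure \<Rightarrow> real measure set" where
  "shadow_competitors \<nu> \<mu> = {\<eta> \<in> finite_moment_measures. \<mu> \<le>cx \<eta> \<and> \<eta> \<le> \<nu>}"

definition is_shadow :: "real measure \<Rightarrow> real measure \<Rightarrow> real measure \<Rightarrow> bool" where
  "is_shadow \<nu> \<mu> \<eta> \<longleftrightarrow>
     \<mu> \<le>E \<nu> \<and> \<eta> \<in> shadow_competitors \<nu> \<mu> \<and> (\<forall>\<eta>' \<in> shadow_competitors \<nu> \<mu>. \<eta> \<le>cx \<eta>')"

definition left_curtain :: "real measure \<Rightarrow> real measure \<Rightarrow> (real \<times> real) measure \<Rightarrow> bool" where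
  "left_curtain \<mu> \<nu> \<pi> \<longleftrightarrow>
     \<pi> \<in> martingale_transports \<mu> \<nu> \<and>
     (\<forall>x. is_shadow \<nu> (restr_measure \<mu> {..x})
            (distr (restr_measure \<pi> ({..x} \<times> UNIV)) borel snd))"

definition plus_measure :: "'a measure \<Rightarrow> 'a measure \<Rightarrow> 'a measure" where
  "plus_measure M N = measure_of (space M) (sets M) (\<lambda>A. emeasure M A + emeasure N A)"

lemma sets_plus_measure [simp, measurable_cong]: "sets (plus_measure M N) = sets M"
  by (simp add: plus_measure_def)

lemma emeasure_plus_measure:
  assumes "sets N = sets M"
  shows "emeasure (plus_measure M N) A = emeasure M A + emeasure N A"
proof (cases "A \<in> sets M")
  case True
  show ?thesis
    unfolding plus_measure_def
  proof (rule emeasure_measure_of_sigma)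
    show "sigma_algebra (space M) (sets M)" ..
    show "positive (sets M) (\<lambda>A. emeasure M A + emeasure N A)"
      by (simp add: positive_def)
    show "countably_additive (sets M) (\<lambda>A. emeasure M A + emeasure N A)"
      unfolding countably_additive_def
      using assms by (auto simp: suminf_add[symmetric] suminf_emeasure)
  qed (fact True)
next
  case False
  then show ?thesis
    using assms by (simp add: emeasure_notin_sets)
qed

definition S_rg :: "(real \<Rightarrow> real) \<Rightarrow> (real \<times> real) set" where
  "S_rg h = {(h y, y) | y. True}"

definition S_diag :: "(real \<times> real) set" where
  "S_diag = {(x, x) | x. True}"

definition S_atom :: "real measure \<Rightarrow> (real \<times> real) set" where
  "S_atom \<nu> = {(x, y) | x y. measure \<nu> {y} > 0}"

end

theory Submission
  imports Defs
begin

text \<open>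
  If, for some \<open>q\<close>, the points \<open>x \<le> q\<close> that send mass both below \<open>a\<close> and above \<open>b\<close> have positive mass
  while the points \<open>x > q\<close> send mass into \<open>(a, b)\<close>, then trading some of the former mass, in a
  barycentre-preserving way, for some of the latter produces a competitor of the shadow of
  \<open>\<mu>|\<^bsub>(-\<infinity>,q]\<^esub>\<close> on which the convex function
  \<open>\<bar>y - (a + b) / 2\<bar> - (b - a) / 2\<close> has a smaller integral. Hence \<open>\<pi>\<close> is carried by a
  left-monotone set. In such a set, off the sources that stay put, only countably many \<open>y\<close> have two
  sources: each of them is labelled by rationals separating \<open>y\<close> and its sources. Finally, if
  \<open>\<nu> \<le> \<mu>\<close> where \<open>\<mu>\<close> lives, the points that stay put already exhaust \<open>\<nu>\<close> there, so no other point
  can be sent to them and \<open>h\<close> may be set to the identity on them.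
\<close>

subsection \<open>Left-monotone planar sets\<close>

text \<open>The exchange excludes a crossing only up to a null set that depends on \<open>q\<close>,
  \<open>a\<close> and \<open>b\<close>. Therefore all levels are rational, and the pointwise
  argument runs on one set on which the countably many exclusions hold together. That a source sends
  mass to a region is expressed by positivity of the conditional expectation, given the first
  coordinate, of the indicator of the region. Sources that stay put are separated because the
  geometric argument needs mass strictly on both sides of the source, and the martingale property
  yields this for almost every source that moves. The convex function of the exchange vanishes at
  \<open>a\<close> and \<open>b\<close>, is negative between them and nonnegative outside; only
  these signs matter. The countable set of targets with two sources costs nothing, since those of
  its points that are not atoms of \<nu> form a \<nu>-null set.\<close>

lemma countable_by_labels:
  assumes "countable Q" and "\<And>y. y \<in> T \<Longrightarrow> \<exists>q\<in>Q. P y q"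
    and "\<And>y z q. P y q \<Longrightarrow> P z q \<Longrightarrow> y = z"
  shows "countable T"
proof -
  obtain f where f: "\<And>y. y \<in> T \<Longrightarrow> f y \<in> Q \<and> P y (f y)"
    using assms(2) by metis
  have "inj_on f T"
    using f assms(3) by (metis inj_onI)
  moreover have "f ` T \<subseteq> Q"
    using f by auto
  ultimately show ?thesis
    using assms(1) countable_subset countable_image_inj_on by metis
qed

text \<open>In the application \<open>l\<close> is a level below \<open>x\<close> to which
  \<open>x\<close> also sends mass, and \<open>u\<close> is such a level above \<open>x\<close>; no
  source further right may land between this level and \<open>y\<close>. Off the diagonal, two
  targets with one label would let the left source of one and the right source of the other violate
  such a gap. The cases are a diagonal target, and a target above or below its left source.\<close>

lemma countable_shared_targets:
  fixes G :: "(real \<times> real) set"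
  assumes up: "\<And>x y. (x, y) \<in> G \<Longrightarrow> x \<le> y \<Longrightarrow>
      \<exists>l<x. \<forall>x' y'. (x', y') \<in> G \<and> x < x' \<longrightarrow> y' \<notin> {l<..<y}"
    and down: "\<And>x y. (x, y) \<in> G \<Longrightarrow> y \<le> x \<Longrightarrow>
      \<exists>u>x. \<forall>x' y'. (x', y') \<in> G \<and> x < x' \<longrightarrow> y' \<notin> {y<..<u}"
  shows "countable {y. \<exists>x x'. x < x' \<and> (x, y) \<in> G \<and> (x', y) \<in> G}"
proof -
  \<comment> \<open>A diagonal point has a gap to its right, given by \<open>down\<close> with
    \<open>x = y\<close>, that contains no further diagonal point; the label lies in this
    gap.\<close>
  define P0 where "P0 y q \<longleftrightarrow> y < q \<and> (y, y) \<in> G \<and> (\<forall>z. (z, z) \<in> G \<and> y < z \<longrightarrow> q < z)" for y q :: real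
  have "countable {y. (y, y) \<in> G}"
  proof (rule countable_by_labels[where Q = "\<rat>" and P = P0])
    fix y assume "y \<in> {y. (y, y) \<in> G}"
    then have y: "(y, y) \<in> G" by simp
    then obtain u where u: "y < u" "\<And>x' y'. (x', y') \<in> G \<Longrightarrow> y < x' \<Longrightarrow> y' \<notin> {y<..<u}"
      using down[of y y] by auto
    obtain q where "q \<in> \<rat>" "y < q" "q < u"
      using Rats_dense_in_real u(1) by blast
    then show "\<exists>q\<in>\<rat>. P0 y q"
      using u(2) y unfolding P0_def by (intro bexI[of _ q]) force+
  next
    fix y z q assume "P0 y q" "P0 z q"
    then show "y = z"
      unfolding P0_def by (metis linorder_neqE order_less_asym)
  qed (rule countable_rat)
  moreover
  define P1 where "P1 y q \<longleftrightarrow> (\<exists>x x'. x < q \<and> q < x' \<and> q < y \<and> (x, y) \<in> G \<and> (x', y) \<in> G)" for y q :: real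
  \<comment> \<open>The left source \<open>x\<close> of the higher target and the right source
    \<open>x'\<close> of the lower one satisfy \<open>x < q < x'\<close>, and \<open>q < y\<close>
    puts \<open>y\<close> above \<open>l\<close>, hence into the forbidden interval
    \<open>(l, z)\<close>.\<close>
  have P1_asym: False if P: "P1 y q" "P1 z q" and "y < z" for y z q
  proof -
    obtain x' where x': "q < x'" "q < y" "(x', y) \<in> G"
      using P(1) unfolding P1_def by blast
    obtain x where x: "x < q" "q < z" "(x, z) \<in> G"
      using P(2) unfolding P1_def by blast
    obtain l where "l < x" "\<And>x' y'. (x', y') \<in> G \<Longrightarrow> x < x' \<Longrightarrow> y' \<notin> {l<..<z}"
      using up[OF x(3)] x by auto
    from this(1) this(2)[OF x'(3)] show False
      using x x' \<open>y < z\<close> by auto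
  qed
  have "countable {y. \<exists>x x'. x < x' \<and> x < y \<and> (x, y) \<in> G \<and> (x', y) \<in> G}"
  proof (rule countable_by_labels[where Q = "\<rat>" and P = P1])
    fix y assume "y \<in> {y. \<exists>x x'. x < x' \<and> x < y \<and> (x, y) \<in> G \<and> (x', y) \<in> G}"
    then obtain x x' where x: "x < x'" "x < y" "(x, y) \<in> G" "(x', y) \<in> G" by blast
    obtain q where "q \<in> \<rat>" "x < q" "q < min x' y"
      using Rats_dense_in_real[of x "min x' y"] x by auto
    then show "\<exists>q\<in>\<rat>. P1 y q"
      using x unfolding P1_def by auto
  next
    fix y z q assume "P1 y q" "P1 z q"
    then show "y = z"
      using P1_asym linorder_neqE by metis
  qed (rule countable_rat)
  moreover
  \<comment> \<open>Here the target lies left of both sources: the first component separates it from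
    its left source, the second separates the two sources.\<close>
  define P2 where "P2 y qr \<longleftrightarrow> (\<exists>x x'. y < fst qr \<and> fst qr < x \<and> x < snd qr \<and> snd qr < x' \<and>
      (x, y) \<in> G \<and> (x', y) \<in> G)" for y :: real and qr :: "real \<times> real"
  have P2_asym: False if P: "P2 y q" "P2 z q" and "z < y" for y z q
  proof -
    obtain x' where x': "snd q < x'" "y < fst q" "(x', y) \<in> G"
      using P(1) unfolding P2_def by blast
    obtain x where x: "z < fst q" "fst q < x" "x < snd q" "(x, z) \<in> G"
      using P(2) unfolding P2_def by blast
    obtain u where "x < u" "\<And>x' y'. (x', y') \<in> G \<Longrightarrow> x < x' \<Longrightarrow> y' \<notin> {z<..<u}"
      using down[OF x(4)] x by auto
    from this(1) this(2)[OF x'(3)] show False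
      using x x' \<open>z < y\<close> by auto
  qed
  have "countable {y. \<exists>x x'. x < x' \<and> y < x \<and> (x, y) \<in> G \<and> (x', y) \<in> G}"
  proof (rule countable_by_labels[where Q = "\<rat> \<times> \<rat>" and P = P2])
    fix y assume "y \<in> {y. \<exists>x x'. x < x' \<and> y < x \<and> (x, y) \<in> G \<and> (x', y) \<in> G}"
    then obtain x x' where x: "x < x'" "y < x" "(x, y) \<in> G" "(x', y) \<in> G" by blast
    obtain q where "q \<in> \<rat>" "y < q" "q < x"
      using Rats_dense_in_real x(2) by blast
    moreover obtain r where "r \<in> \<rat>" "x < r" "r < x'"
      using Rats_dense_in_real x(1) by blast
    ultimately show "\<exists>q\<in>\<rat>\<times>\<rat>. P2 y q"
      using x unfolding P2_def by (intro bexI[of _ "(q, r)"]) auto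
  next
    fix y z q assume "P2 y q" "P2 z q"
    then show "y = z"
      using P2_asym linorder_neqE by metis
  qed (intro countable_SIGMA countable_rat)
  moreover have "{y. \<exists>x x'. x < x' \<and> (x, y) \<in> G \<and> (x', y) \<in> G} \<subseteq>
      {y. (y, y) \<in> G} \<union> {y. \<exists>x x'. x < x' \<and> x < y \<and> (x, y) \<in> G \<and> (x', y) \<in> G} \<union>
      {y. \<exists>x x'. x < x' \<and> y < x \<and> (x, y) \<in> G \<and> (x', y) \<in> G}"
  proof
    fix y assume "y \<in> {y. \<exists>x x'. x < x' \<and> (x, y) \<in> G \<and> (x', y) \<in> G}"
    then obtain x x' where "x < x'" "(x, y) \<in> G" "(x', y) \<in> G" by blast
    then show "y \<in> {y. (y, y) \<in> G} \<union> {y. \<exists>x x'. x < x' \<and> x < y \<and> (x, y) \<in> G \<and> (x', y) \<in> G} \<union>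
        {y. \<exists>x x'. x < x' \<and> y < x \<and> (x, y) \<in> G \<and> (x', y) \<in> G}"
      by (cases x y rule: linorder_cases) blast+
  qed
  ultimately show ?thesis
    by (metis (no_types, lifting) countable_Un countable_subset)
qed

subsection \<open>Convex functions and the convex order\<close>

text \<open>One slope is chosen at each point. Monotonicity makes this choice Borel and bounded on
  bounded intervals, so that a truncated slope can serve as a weight in the martingale
  identity.\<close>

lemma convex_real_supporting_lines:
  fixes \<phi> :: "real \<Rightarrow> real"
  assumes "convex_on UNIV \<phi>"
  obtains s where "mono s" "\<And>x y. \<phi> x + s x * (y - x) \<le> \<phi> y"
proof -
  have "\<forall>x. \<exists>s. \<forall>y. \<phi> x + s * (y - x) \<le> \<phi> y"
    using convex_le_Inf_differential[OF assms] by (simp, blast)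
  then obtain s where s: "\<And>x y. \<phi> x + s x * (y - x) \<le> \<phi> y"
    by metis
  have "mono s"
  proof (rule monoI)
    fix x y :: real assume "x \<le> y"
    have "(s y - s x) * (y - x) \<ge> 0"
      using s[of x y] s[of y x] by (simp add: algebra_simps)
    then show "s x \<le> s y"
      using \<open>x \<le> y\<close> by (cases "x = y") (auto simp: zero_le_mult_iff)
  qed
  then show ?thesis
    using that s by blast
qed

lemma borel_measurable_convex_real:
  fixes \<phi> :: "real \<Rightarrow> real"
  assumes "convex_on UNIV \<phi>"
  shows "\<phi> \<in> borel_measurable borel"
  using convex_on_continuous[OF _ assms] by (simp add: borel_measurable_continuous_onI)

lemma ext_integral_eq_integral:
  assumes "integrable M \<phi>"
  shows "ext_integral M \<phi> = ereal (\<integral>x. \<phi> x \<partial>M)"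
proof -
  have *: "(\<integral>\<^sup>+x. ennreal (\<phi> x) \<partial>M) \<noteq> \<infinity>" "(\<integral>\<^sup>+x. ennreal (- \<phi> x) \<partial>M) \<noteq> \<infinity>"
    using assms by (auto simp: real_integrable_def)
  then show ?thesis
    unfolding ext_integral_def real_lebesgue_integral_def[OF assms]
    by (cases "\<integral>\<^sup>+x. ennreal (\<phi> x) \<partial>M"; cases "\<integral>\<^sup>+x. ennreal (- \<phi> x) \<partial>M") auto
qed

text \<open>Subtracting the supporting line at 0 makes a convex function nonnegative, and the two
  integrals of the line agree because mass and mean do.\<close>

lemma le_cxI_nonneg_convex:
  fixes M N :: "real measure"
  assumes fin: "finite_measure M" "finite_measure N"
    and sets: "sets M = sets borel" "sets N = sets borel"
    and int: "integrable M (\<lambda>x. x)" "integrable N (\<lambda>x. x)"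
    and mass: "measure M UNIV = measure N UNIV"
    and mean: "(\<integral>x. x \<partial>M) = (\<integral>x. x \<partial>N)"
    and nn: "\<And>\<phi>. convex_on UNIV \<phi> \<Longrightarrow> (\<And>x. 0 \<le> \<phi> x) \<Longrightarrow> integrable N \<phi> \<Longrightarrow>
      (\<integral>\<^sup>+x. ennreal (\<phi> x) \<partial>M) \<le> (\<integral>\<^sup>+x. ennreal (\<phi> x) \<partial>N)"
  shows "M \<le>cx N"
  unfolding le_cx_def
proof (intro allI impI)
  fix \<phi> :: "real \<Rightarrow> real" assume cx: "convex_on UNIV \<phi>"
  interpret M: finite_measure M by fact
  interpret N: finite_measure N by fact
  have sp: "space M = UNIV" "space N = UNIV"
    using sets_eq_imp_space_eq[OF sets(1)] sets_eq_imp_space_eq[OF sets(2)] by simp_all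
  note [measurable] = borel_measurable_convex_real[OF cx]
  obtain s where s: "\<And>x y. \<phi> x + s x * (y - x) \<le> \<phi> y"
    using convex_real_supporting_lines[OF cx] by metis
  define L where "L y = \<phi> 0 + s 0 * y" for y
  have L: "L y \<le> \<phi> y" for y
    using s[of 0 y] unfolding L_def by simp
  have Lint: "integrable M L" "integrable N L"
    unfolding L_def using int by auto
  have Leq: "(\<integral>x. L x \<partial>M) = (\<integral>x. L x \<partial>N)"
    unfolding L_def using int mass mean by (simp add: sp)
  have M\<phi>: "\<phi> \<in> borel_measurable M" and N\<phi>: "\<phi> \<in> borel_measurable N"
    using sets by (simp_all cong: measurable_cong_sets)
  show "ext_integral M \<phi> \<le> ext_integral N \<phi>"
  proof (cases "integrable N \<phi>")
    case True
    have "convex_on UNIV (\<lambda>x. - L x)"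
      unfolding L_def by (rule convex_onI) (simp_all add: algebra_simps)
    from convex_on_add[OF cx this] have cx0: "convex_on UNIV (\<lambda>x. \<phi> x - L x)"
      by simp
    have N0: "integrable N (\<lambda>x. \<phi> x - L x)"
      using True Lint by auto
    have le: "(\<integral>\<^sup>+x. ennreal (\<phi> x - L x) \<partial>M) \<le> (\<integral>\<^sup>+x. ennreal (\<phi> x - L x) \<partial>N)"
      using nn[OF cx0 _ N0] L by simp
    also have "\<dots> = ennreal (\<integral>x. \<phi> x - L x \<partial>N)"
      using nn_integral_eq_integral[OF N0] L by simp
    finally have le2: "(\<integral>\<^sup>+x. ennreal (\<phi> x - L x) \<partial>M) \<le> ennreal (\<integral>x. \<phi> x - L x \<partial>N)" .
    then have M0: "integrable M (\<lambda>x. \<phi> x - L x)"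
    proof (intro integrableI_nonneg)
      show "(\<lambda>x. \<phi> x - L x) \<in> borel_measurable M"
        using M\<phi> Lint(1) by (intro borel_measurable_diff) auto
    qed (use L le_less_trans[OF le2] in auto)
    have "(\<integral>x. \<phi> x - L x \<partial>M) \<le> (\<integral>x. \<phi> x - L x \<partial>N)"
      using le2 nn_integral_eq_integral[OF M0] L by (simp add: integral_nonneg_AE)
    moreover have "integrable M \<phi>"
      using Bochner_Integration.integrable_add[OF M0 Lint(1)] by simp
    ultimately show ?thesis
      using True Leq Lint by (simp add: ext_integral_eq_integral)
  next
    \<comment> \<open>The line \<open>L\<close> controls the negative part, so failure of
      integrability can only mean that the integral is plus infinity.\<close>
    case False
    have "(\<integral>\<^sup>+x. ennreal (- \<phi> x) \<partial>N) \<le> (\<integral>\<^sup>+x. ennreal (- L x) \<partial>N)"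
      using L by (intro nn_integral_mono ennreal_leI) auto
    also have "\<dots> < \<infinity>"
      using Lint(2) by (auto simp: real_integrable_def less_top)
    finally have neg: "(\<integral>\<^sup>+x. ennreal (- \<phi> x) \<partial>N) \<noteq> \<infinity>" by simp
    then have "(\<integral>\<^sup>+x. ennreal (\<phi> x) \<partial>N) = \<infinity>"
      using False N\<phi> unfolding real_integrable_def by blast
    then have "ext_integral N \<phi> = \<infinity>"
      unfolding ext_integral_def using neg
      by (cases "\<integral>\<^sup>+x. ennreal (- \<phi> x) \<partial>N") auto
    then show ?thesis by simp
  qed
qed

subsection \<open>Measurable graphs\<close>

text \<open>
  Inner regularity replaces the Lusin--Souslin theorem: only a \<open>\<sigma>\<close>-compact part of \<open>G\<close> of full
  measure is used, whose projections are Borel.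
\<close>

lemma graph_function_of_inj_snd:
  fixes \<pi> :: "(real \<times> real) measure"
  assumes "finite_measure \<pi>" and sets: "sets \<pi> = sets borel" and G: "G \<in> sets borel"
    and inj: "inj_on snd G"
  obtains h where "h \<in> borel_measurable borel" "AE z in \<pi>. z \<in> G \<longrightarrow> h (snd z) = fst z"
proof -
  interpret finite_measure \<pi> by fact
  have reg: "emeasure \<pi> G = (SUP K\<in>{K. K \<subseteq> G \<and> compact K}. emeasure \<pi> K)"
    by (rule inner_regular[OF sets _ G]) simp
  have "\<exists>K. range K \<subseteq> {K. K \<subseteq> G \<and> compact K} \<and> (SUP n::nat. emeasure \<pi> (K n)) = emeasure \<pi> G"
  proof -
    have "{K. K \<subseteq> G \<and> compact K} \<noteq> {}" by auto
    from ennreal_SUP_countable_SUP[OF this, of "emeasure \<pi>"]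
    obtain f where f: "range f \<subseteq> emeasure \<pi> ` {K. K \<subseteq> G \<and> compact K}" "(SUP n::nat. f n) = emeasure \<pi> G"
      unfolding reg by metis
    then have "\<forall>n. \<exists>K. K \<subseteq> G \<and> compact K \<and> f n = emeasure \<pi> K" by blast
    then obtain K where "\<And>n. K n \<subseteq> G \<and> compact (K n) \<and> f n = emeasure \<pi> (K n)" by metis
    then show ?thesis using f(2) by (intro exI[of _ K]) auto
  qed
  then obtain K where K: "\<And>n::nat. K n \<subseteq> G" "\<And>n. compact (K n)"
    and sup: "(SUP n. emeasure \<pi> (K n)) = emeasure \<pi> G" by blast
  define U where "U = (\<Union>n. K n)"
  have UG: "U \<subseteq> G" unfolding U_def using K by auto
  have Us: "U \<in> sets \<pi>" unfolding U_def sets using K(2) by (auto intro: borel_compact)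
  have "emeasure \<pi> G \<le> emeasure \<pi> U"
    unfolding sup[symmetric] by (intro SUP_least emeasure_mono Us) (auto simp: U_def)
  then have "emeasure \<pi> (G - U) = 0"
    using UG Us G sets by (subst emeasure_Diff) (auto simp: diff_eq_0_iff_ennreal less_top[symmetric])
  then have null: "G - U \<in> null_sets \<pi>"
    using G Us sets by auto
  \<comment> \<open>The default 0 outside the projection of \<open>U\<close> adds the complement of
    that projection to \<open>{y. c \<le> h y}\<close> when \<open>c \<le> 0\<close>.\<close>
  define h where "h y = (if y \<in> snd ` U then fst (inv_into U snd y) else 0)" for y
  have injU: "inj_on snd U" using inj UG inj_on_subset by blast
  have h: "h (snd z) = fst z" if "z \<in> U" for z
    unfolding h_def using that injU by simp
  have proj: "snd ` (U \<inter> ({c..} \<times> UNIV)) \<in> sets borel" for c :: real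
  proof -
    have "compact (snd ` (K n \<inter> ({c..} \<times> UNIV)))" for n
      by (intro compact_continuous_image compact_Int_closed K closed_Times continuous_intros)
    then have "(\<Union>n. snd ` (K n \<inter> ({c..} \<times> UNIV))) \<in> sets borel"
      by (intro sets.countable_UN) (auto intro: borel_compact)
    also have "(\<Union>n. snd ` (K n \<inter> ({c..} \<times> UNIV))) = snd ` (U \<inter> ({c..} \<times> UNIV))"
      unfolding U_def by blast
    finally show ?thesis .
  qed
  have proj': "snd ` U \<in> sets borel"
    unfolding U_def image_UN by (intro sets.countable_UN) (auto intro!: borel_compact compact_continuous_image K continuous_intros)
  have "h \<in> borel_measurable borel"
  proof (rule borel_measurableI_ge)
    fix c :: real
    have "{y \<in> space borel. c \<le> h y} = snd ` (U \<inter> ({c..} \<times> UNIV)) \<union> (if c \<le> 0 then - snd ` U else {})"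
    proof (intro set_eqI)
      fix y show "y \<in> {y \<in> space borel. c \<le> h y} \<longleftrightarrow> y \<in> snd ` (U \<inter> ({c..} \<times> UNIV)) \<union> (if c \<le> 0 then - snd ` U else {})"
      proof (cases "y \<in> snd ` U")
        case True
        then obtain z where z: "z \<in> U" "y = snd z" by blast
        have "y \<in> snd ` (U \<inter> ({c..} \<times> UNIV)) \<longleftrightarrow> c \<le> fst z"
          using z injU by (cases z) (force simp: inj_on_def)
        then show ?thesis using z h[OF z(1)] True by auto
      next
        case False
        then show ?thesis by (auto simp: h_def)
      qed
    qed
    then show "{y \<in> space borel. c \<le> h y} \<in> sets borel"
      using proj proj' by auto
  qed
  moreover have "AE z in \<pi>. z \<in> G \<longrightarrow> h (snd z) = fst z"
    using AE_not_in[OF null] by eventually_elim (use h in auto)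
  ultimately show ?thesis using that by blast
qed

subsection \<open>Martingale couplings\<close>

locale martingale_coupling = prob_space \<pi> for \<pi> :: "(real \<times> real) measure" +
  assumes sets_eq: "sets \<pi> = sets borel"
    and integrable_fst: "integrable \<pi> fst"
    and integrable_snd: "integrable \<pi> snd"
    and martingale: "AE z in \<pi>. real_cond_exp \<pi> (vimage_algebra (space \<pi>) fst borel) snd z = fst z"
begin

definition F :: "(real \<times> real) measure" where
  "F = vimage_algebra (space \<pi>) fst borel"

text \<open>\<open>E f\<close> depends on the source alone and plays the part of the integral of
  \<open>f\<close> against the conditional law given the source; it replaces a disintegration of
  \<pi>.\<close>

abbreviation E :: "(real \<times> real \<Rightarrow> real) \<Rightarrow> real \<times> real \<Rightarrow> real" where
  "E \<equiv> real_cond_exp \<pi> F"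

lemma space_eq: "space \<pi> = UNIV"
  using sets_eq_imp_space_eq[OF sets_eq] by simp

lemma measurable_fst_\<pi> [measurable]: "fst \<in> borel_measurable \<pi>"
  using integrable_fst by simp

lemma measurable_snd_\<pi> [measurable]: "snd \<in> borel_measurable \<pi>"
  using integrable_snd by simp

lemma measurable_fst_F [measurable]: "fst \<in> borel_measurable F"
  unfolding F_def by (rule measurable_vimage_algebra1) simp

lemma space_F: "space F = UNIV"
  unfolding F_def by (simp add: space_eq)

lemma sets_F_iff: "N \<in> sets F \<longleftrightarrow> (\<exists>A\<in>sets borel. N = fst -` A)"
  unfolding F_def by (subst sets_vimage_algebra2) (auto simp: space_eq)

sublocale finite_measure_subalgebra \<pi> F
proof
  show "subalgebra \<pi> F"
    unfolding subalgebra_def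
    using measurable_sets[OF measurable_fst_\<pi>]
    by (auto simp: space_eq space_F sets_F_iff)
qed

lemma measurable_F_\<pi>: "f \<in> borel_measurable F \<Longrightarrow> f \<in> borel_measurable \<pi>"
  by (rule measurable_from_subalg[OF subalg])

lemma integrable_bounded_mult:
  fixes f Z :: "real \<times> real \<Rightarrow> real"
  assumes "integrable \<pi> f" "Z \<in> borel_measurable \<pi>" "\<And>z. \<bar>Z z\<bar> \<le> C"
  shows "integrable \<pi> (\<lambda>z. Z z * f z)"
proof (rule Bochner_Integration.integrable_bound)
  show "integrable \<pi> (\<lambda>z. C * f z)" using assms by simp
  have "0 \<le> C" using assms(3)[of undefined] by linarith
  then show "AE z in \<pi>. norm (Z z * f z) \<le> norm (C * f z)"
    using assms(3) by (intro AE_I2) (simp add: abs_mult mult_right_mono)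
qed (use assms in simp)

section \<open>Conditional expectations given the source\<close>

lemma cond_exp_bounded_factor:
  assumes "integrable \<pi> f" "Z \<in> borel_measurable F" "\<And>z. \<bar>Z z\<bar> \<le> C"
  shows "(\<integral>z. Z z * f z \<partial>\<pi>) = (\<integral>z. Z z * E f z \<partial>\<pi>)"
  using assms integrable_bounded_mult[OF assms(1) measurable_F_\<pi>[OF assms(2)] assms(3)]
  by (intro real_cond_exp_intg(2)[symmetric]) auto

text \<open>Weak form of the martingale property, used below with \<open>Z\<close> an indicator of a
  set of sources or a truncated slope.\<close>

lemma martingale_integral:
  assumes [measurable]: "Z \<in> borel_measurable F" and "\<And>z. \<bar>Z z\<bar> \<le> C"
  shows "(\<integral>z. Z z * (snd z - fst z) \<partial>\<pi>) = 0"
proof -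
  have [measurable]: "Z \<in> borel_measurable \<pi>" by (rule measurable_F_\<pi>) fact
  have "(\<integral>z. Z z * snd z \<partial>\<pi>) = (\<integral>z. Z z * E snd z \<partial>\<pi>)"
    by (rule cond_exp_bounded_factor[OF integrable_snd]) fact+
  also have "\<dots> = (\<integral>z. Z z * fst z \<partial>\<pi>)"
    using martingale by (intro integral_cong_AE) (auto simp: F_def[symmetric])
  finally show ?thesis
    using integrable_bounded_mult[OF integrable_snd _ assms(2)]
      integrable_bounded_mult[OF integrable_fst _ assms(2)]
    by (simp add: algebra_simps)
qed

text \<open>A nonnegative function and its conditional expectation have the same integral over a set
  of sources, so each vanishes there when the other does; the next lemma is the other direction. The
  form \<open>\<le> 0\<close> negates the statement that positive mass is sent.\<close>

lemma cond_exp_le_0_on: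
  assumes "N \<in> sets F" "integrable \<pi> h" "\<And>z. 0 \<le> h z" and "AE z in \<pi>. z \<in> N \<longrightarrow> h z = 0"
  shows "AE z in \<pi>. z \<in> N \<longrightarrow> E h z \<le> 0"
proof -
  have [measurable]: "N \<in> sets F" "N \<in> sets \<pi>"
    using assms(1) subalg unfolding subalgebra_def by auto
  have [measurable]: "h \<in> borel_measurable \<pi>"
    using assms(2) by simp
  have [measurable]: "E h \<in> borel_measurable \<pi>"
    by (rule measurable_F_\<pi>) simp
  have Z: "indicator N \<in> borel_measurable F" "\<And>z. \<bar>indicator N z :: real\<bar> \<le> 1"
    by (auto simp: indicator_def)
  have Eh: "AE z in \<pi>. 0 \<le> E h z"
    using assms by (intro real_cond_exp_pos) auto
  have "(\<integral>z. indicator N z * E h z \<partial>\<pi>) = (\<integral>z. indicator N z * h z \<partial>\<pi>)"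
    by (rule cond_exp_bounded_factor[OF assms(2) Z, symmetric])
  also have "\<dots> = (\<integral>z. 0 \<partial>\<pi>)"
    using assms(4) by (intro integral_cong_AE) (auto simp: indicator_def)
  finally have "AE z in \<pi>. indicator N z * E h z = 0"
    using Eh integrable_bounded_mult[OF real_cond_exp_int(1)[OF assms(2)] measurable_F_\<pi>[OF Z(1)] Z(2)]
    by (subst integral_nonneg_eq_0_iff_AE[symmetric]) auto
  then show ?thesis by eventually_elim auto
qed

lemma eq_0_on_cond_exp_le_0:
  assumes "N \<in> sets F" "integrable \<pi> h" "\<And>z. 0 \<le> h z" and "AE z in \<pi>. z \<in> N \<longrightarrow> E h z \<le> 0"
  shows "AE z in \<pi>. z \<in> N \<longrightarrow> h z = 0"
proof -
  have [measurable]: "N \<in> sets F" "N \<in> sets \<pi>"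
    using assms(1) subalg unfolding subalgebra_def by auto
  have [measurable]: "h \<in> borel_measurable \<pi>"
    using assms(2) by simp
  have [measurable]: "E h \<in> borel_measurable \<pi>"
    by (rule measurable_F_\<pi>) simp
  have Z: "indicator N \<in> borel_measurable F" "\<And>z. \<bar>indicator N z :: real\<bar> \<le> 1"
    by (auto simp: indicator_def)
  have Eh: "AE z in \<pi>. 0 \<le> E h z"
    using assms by (intro real_cond_exp_pos) auto
  have "(\<integral>z. indicator N z * h z \<partial>\<pi>) = (\<integral>z. indicator N z * E h z \<partial>\<pi>)"
    by (rule cond_exp_bounded_factor[OF assms(2) Z])
  also have "\<dots> = (\<integral>z. 0 \<partial>\<pi>)"
    using assms(4) Eh
    by (intro integral_cong_AE) (auto simp: indicator_def)
  finally have "AE z in \<pi>. indicator N z * h z = 0"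
    using assms(3) integrable_bounded_mult[OF assms(2) measurable_F_\<pi>[OF Z(1)] Z(2)]
    by (subst integral_nonneg_eq_0_iff_AE[symmetric]) auto
  then show ?thesis by eventually_elim auto
qed

lemma integrable_real_pred:
  assumes "Measurable.pred \<pi> P"
  shows "integrable \<pi> (indicator {z. P z} :: _ \<Rightarrow> real)"
  using assms by (auto simp: space_eq pred_def less_top[symmetric] intro!: integrable_real_indicator)

text \<open>
  On the set of \<open>x\<close> without targets on one side, \<open>Y - X\<close> has a sign and mean zero.
  The factor \<open>\<sigma> = \<plusminus>1\<close> covers both sides at once.
\<close>

lemma mass_on_both_sides:
  assumes "\<sigma> \<noteq> 0"
  shows "AE z in \<pi>. 0 < E (indicator {z. snd z \<noteq> fst z}) z \<longrightarrow>
    (\<exists>a::rat. \<sigma> * of_rat a < \<sigma> * fst z \<and> 0 < E (indicator {z. \<sigma> * snd z \<le> \<sigma> * of_rat a}) z)"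
proof -
  define w where "w = E (indicator {z. snd z \<noteq> fst z})"
  define p where "p a = E (indicator {z. \<sigma> * snd z \<le> \<sigma> * of_rat a})" for a :: rat
  have [measurable]: "w \<in> borel_measurable F" "\<And>a. p a \<in> borel_measurable F"
    unfolding w_def p_def by simp_all
  \<comment> \<open>Moving sources that send no mass beyond any rational level on the side chosen by
    \<open>\<sigma>\<close>. The set belongs to \<open>F\<close>, so its indicator is an admissible
    weight in \<open>martingale_integral\<close>.\<close>
  define N where "N = {z. 0 < w z \<and> (\<forall>a. \<sigma> * of_rat a < \<sigma> * fst z \<longrightarrow> p a z \<le> 0)}"
  have "{z \<in> space F. 0 < w z \<and> (\<forall>a. \<sigma> * of_rat a < \<sigma> * fst z \<longrightarrow> p a z \<le> 0)} \<in> sets F"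
    by measurable
  then have NF [measurable]: "N \<in> sets F"
    unfolding N_def space_F by simp
  have [measurable]: "N \<in> sets \<pi>"
    using NF subalg unfolding subalgebra_def by auto
  have Z: "indicator N \<in> borel_measurable F" "\<And>z. \<bar>indicator N z :: real\<bar> \<le> 1"
    by (auto simp: indicator_def)
  have "AE z in \<pi>. z \<in> N \<inter> {z. \<sigma> * of_rat a < \<sigma> * fst z} \<longrightarrow>
      (indicator {z. \<sigma> * snd z \<le> \<sigma> * of_rat a} z :: real) = 0" for a :: rat
  proof (rule eq_0_on_cond_exp_le_0)
    have "{z \<in> space F. \<sigma> * of_rat a < \<sigma> * fst z} \<in> sets F"
      by measurable
    then show "N \<inter> {z. \<sigma> * of_rat a < \<sigma> * fst z} \<in> sets F"
      by (auto simp: space_F)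
    show "AE z in \<pi>. z \<in> N \<inter> {z. \<sigma> * of_rat a < \<sigma> * fst z} \<longrightarrow>
        E (indicator {z. \<sigma> * snd z \<le> \<sigma> * of_rat a}) z \<le> 0"
      by (auto simp: N_def p_def)
  qed (auto intro!: integrable_real_pred)
  then have "AE z in \<pi>. \<forall>a::rat. z \<in> N \<inter> {z. \<sigma> * of_rat a < \<sigma> * fst z} \<longrightarrow>
      (indicator {z. \<sigma> * snd z \<le> \<sigma> * of_rat a} z :: real) = 0"
    by (simp add: AE_all_countable)
  then have ge: "AE z in \<pi>. z \<in> N \<longrightarrow> \<sigma> * fst z \<le> \<sigma> * snd z"
  proof eventually_elim
    case (elim z)
    show ?case
    proof (rule impI)
      assume "z \<in> N"
      show "\<sigma> * fst z \<le> \<sigma> * snd z"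
      proof (rule ccontr)
        assume "\<not> \<sigma> * fst z \<le> \<sigma> * snd z"
        then have "\<exists>a::rat. \<sigma> * of_rat a < \<sigma> * fst z \<and> \<sigma> * snd z \<le> \<sigma> * of_rat a"
          using assms of_rat_dense[of "snd z" "fst z"] of_rat_dense[of "fst z" "snd z"]
          by (cases "\<sigma> < 0") (auto simp: mult_less_cancel_left mult_le_cancel_left not_le intro: less_imp_le)
        then show False
          using elim \<open>z \<in> N\<close> by auto
      qed
    qed
  qed
  have int: "integrable \<pi> (\<lambda>z. indicator N z * (snd z - fst z))"
    by (rule integrable_bounded_mult[OF _ _ Z(2)])
      (auto intro: integrable_fst integrable_snd measurable_F_\<pi> Z(1))
  have "(\<integral>z. \<sigma> * (indicator N z * (snd z - fst z)) \<partial>\<pi>) = 0"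
    using martingale_integral[OF Z] by simp
  then have "AE z in \<pi>. \<sigma> * (indicator N z * (snd z - fst z)) = 0"
  proof (subst integral_nonneg_eq_0_iff_AE[symmetric])
    show "AE z in \<pi>. 0 \<le> \<sigma> * (indicator N z * (snd z - fst z))"
      using ge by eventually_elim (auto simp: indicator_def algebra_simps)
  qed (use int in auto)
  then have "AE z in \<pi>. z \<in> N \<longrightarrow> (indicator {z. snd z \<noteq> fst z} z :: real) = 0"
    using assms by (auto simp: indicator_def)
  then have "AE z in \<pi>. z \<in> N \<longrightarrow> w z \<le> 0"
    unfolding w_def by (intro cond_exp_le_0_on) (auto intro!: integrable_real_pred)
  then show ?thesis
    by eventually_elim (auto simp: N_def w_def p_def not_le)
qed


subsection \<open>Competitors of the shadow\<close>

text \<open>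
  All competitors needed are second marginals of \<open>k \<cdot> \<pi>\<close> with a density \<open>0 \<le> k \<le> 1\<close>, so that
  they are automatically dominated by \<open>\<nu>\<close>.
\<close>

definition push :: "(real \<times> real \<Rightarrow> real) \<Rightarrow> (real \<times> real \<Rightarrow> real) \<Rightarrow> real measure" where
  "push k f = distr (density \<pi> (\<lambda>z. ennreal (k z))) borel f"

lemma
  assumes [measurable]: "k \<in> borel_measurable \<pi>" "f \<in> borel_measurable \<pi>"
    and k: "\<And>z. 0 \<le> k z"
  shows sets_push: "sets (push k f) = sets borel"
    and nn_integral_push: "\<phi> \<in> borel_measurable borel \<Longrightarrow>
      (\<integral>\<^sup>+x. ennreal (\<phi> x) \<partial>push k f) = (\<integral>\<^sup>+z. ennreal (k z * \<phi> (f z)) \<partial>\<pi>)"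
    and integrable_push_iff: "\<phi> \<in> borel_measurable borel \<Longrightarrow>
      integrable (push k f) \<phi> \<longleftrightarrow> integrable \<pi> (\<lambda>z. k z * \<phi> (f z))"
    and integral_push: "\<phi> \<in> borel_measurable borel \<Longrightarrow>
      (\<integral>x. \<phi> x \<partial>push k f) = (\<integral>z. k z * \<phi> (f z) \<partial>\<pi>)"
proof -
  show "sets (push k f) = sets borel"
    by (simp add: push_def)
  assume [measurable]: "\<phi> \<in> borel_measurable borel"
  show "(\<integral>\<^sup>+x. ennreal (\<phi> x) \<partial>push k f) = (\<integral>\<^sup>+z. ennreal (k z * \<phi> (f z)) \<partial>\<pi>)"
    unfolding push_def using k by (simp add: nn_integral_distr nn_integral_density ennreal_mult')
  show "integrable (push k f) \<phi> \<longleftrightarrow> integrable \<pi> (\<lambda>z. k z * \<phi> (f z))"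
    unfolding push_def using k by (simp add: integrable_distr_eq integrable_density)
  show "(\<integral>x. \<phi> x \<partial>push k f) = (\<integral>z. k z * \<phi> (f z) \<partial>\<pi>)"
    unfolding push_def using k by (simp add: integral_distr integral_density)
qed

lemma
  assumes [measurable]: "k \<in> borel_measurable \<pi>" "f \<in> borel_measurable \<pi>"
    and k: "\<And>z. 0 \<le> k z" "\<And>z. k z \<le> 1"
  shows finite_measure_push: "finite_measure (push k f)"
    and measure_push: "measure (push k f) UNIV = (\<integral>z. k z \<partial>\<pi>)"
    and push_le: "push k f \<le> distr \<pi> borel f"
proof -
  have em: "emeasure (push k f) A = (\<integral>\<^sup>+z. ennreal (k z) * indicator (f -` A) z \<partial>\<pi>)" if "A \<in> sets borel" for A
    unfolding push_def using that measurable_sets[OF assms(2) that]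
    by (simp add: emeasure_distr emeasure_density space_eq)
  have le: "emeasure (push k f) A \<le> emeasure (distr \<pi> borel f) A" if "A \<in> sets borel" for A
  proof -
    have "emeasure (push k f) A \<le> (\<integral>\<^sup>+z. indicator (f -` A) z \<partial>\<pi>)"
      unfolding em[OF that] using k by (intro nn_integral_mono) (auto simp: indicator_def)
    also have "\<dots> = emeasure (distr \<pi> borel f) A"
      using that measurable_sets[OF assms(2) that] by (simp add: emeasure_distr space_eq)
    finally show ?thesis .
  qed
  have le': "emeasure (push k f) A \<le> emeasure (distr \<pi> borel f) A" for A
    using le by (cases "A \<in> sets borel") (auto simp: emeasure_notin_sets push_def)
  show "push k f \<le> distr \<pi> borel f"
    by (subst le_measure) (auto simp: push_def le'[unfolded push_def])
  show "finite_measure (push k f)"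
  proof
    have "emeasure (push k f) UNIV \<le> emeasure (distr \<pi> borel f) UNIV"
      by (rule le')
    also have "\<dots> < \<infinity>"
      by (simp add: emeasure_distr less_top[symmetric])
    finally show "emeasure (push k f) (space (push k f)) \<noteq> \<infinity>"
      by (simp add: push_def)
  qed
  show "measure (push k f) UNIV = (\<integral>z. k z \<partial>\<pi>)"
    unfolding measure_def using k(1)
    by (subst em) (simp_all add: integral_eq_nn_integral)
qed

lemma integral_pos:
  fixes f :: "real \<times> real \<Rightarrow> real"
  assumes f: "integrable \<pi> f" "\<And>z. 0 \<le> f z" "\<And>z. z \<in> W \<Longrightarrow> 0 < f z" and "0 < prob W"
  shows "0 < (\<integral>z. f z \<partial>\<pi>)"
proof (rule ccontr)
  assume "\<not> 0 < (\<integral>z. f z \<partial>\<pi>)"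
  moreover have "0 \<le> (\<integral>z. f z \<partial>\<pi>)"
    by (intro Bochner_Integration.integral_nonneg f(2))
  ultimately have "(\<integral>z. f z \<partial>\<pi>) = 0"
    by linarith
  then have "AE z in \<pi>. f z = 0"
    using f by (simp add: integral_nonneg_eq_0_iff_AE)
  then have "AE z in \<pi>. z \<notin> W"
    by eventually_elim (use f(3) in force)
  moreover have "W \<in> events"
    using \<open>0 < prob W\<close> measure_notin_sets by fastforce
  ultimately have "prob W = 0"
    by (simp add: AE_iff_measurable[OF _ refl] prob_eq_0)
  then show False using \<open>0 < prob W\<close> by simp
qed

text \<open>
  The mass \<open>g\<close> withdrawn from \<open>x\<close> has barycentre \<open>c\<close> by \<open>balance\<close>, which is also that of the
  mass added on \<open>W\<close>. In the proof the supporting lines are integrated over \<open>\<bar>x\<bar> \<le> n\<close>, where their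
  slopes are bounded.
\<close>

lemma modified_marginal_le_cx:
  fixes g :: "real \<times> real \<Rightarrow> real"
  assumes g [measurable]: "g \<in> borel_measurable \<pi>"
    and g01: "\<And>z. 0 \<le> g z" "\<And>z. g z \<le> indicator {z. fst z \<le> q} z"
    and balance: "\<And>Z C. Z \<in> borel_measurable F \<Longrightarrow> (\<And>z. \<bar>Z z\<bar> \<le> C) \<Longrightarrow>
      (\<integral>z. Z z * (g z * (c - snd z)) \<partial>\<pi>) = 0"
    and W [measurable]: "W \<in> sets \<pi>" and Wq: "W \<subseteq> {z. q < fst z}"
    and t: "0 \<le> t" "t \<le> 1" and gt: "(\<integral>z. g z \<partial>\<pi>) = t * prob W"
    and Wc: "(\<integral>z. indicator W z * (snd z - c) \<partial>\<pi>) = 0"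
  shows "push (indicator {z. fst z \<le> q}) fst \<le>cx
    push (\<lambda>z. indicator {z. fst z \<le> q} z - g z + t * indicator W z) snd"
proof -
  define j :: "real \<times> real \<Rightarrow> real" where "j = indicator {z. fst z \<le> q}"
  define k where "k z = j z - g z + t * indicator W z" for z
  have pq: "{z. fst z \<le> q} \<in> sets \<pi>"
    using measurable_sets[OF measurable_fst_\<pi>, of "{..q}"] by (simp add: vimage_def space_eq)
  have j [measurable]: "j \<in> borel_measurable \<pi>"
    unfolding j_def using pq by simp
  have jF [measurable]: "j \<in> borel_measurable F"
  proof -
    have "{z \<in> space F. fst z \<le> q} \<in> sets F" by measurable
    then show ?thesis unfolding j_def by (simp add: space_F)
  qed
  have j01: "0 \<le> j z" "j z \<le> 1" "\<bar>j z\<bar> \<le> 1" for z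
    unfolding j_def by (auto simp: indicator_def)
  have gj: "g z \<le> j z" for z using g01 unfolding j_def by simp
  have g1: "g z \<le> 1" "\<bar>g z\<bar> \<le> 1" for z
    using gj[of z] j01[of z] g01(1)[of z] by auto
  have kmeas [measurable]: "k \<in> borel_measurable \<pi>"
    unfolding k_def by measurable
  have tW: "0 \<le> t * indicator W z" "t * indicator W z \<le> 1" for z
    using t by (auto simp: indicator_def)
  have k01: "0 \<le> k z" "k z \<le> 1" for z
  proof -
    show "0 \<le> k z" unfolding k_def using gj[of z] tW[of z] by simp
    show "k z \<le> 1" unfolding k_def using g01(1)[of z] Wq t
      by (cases "z \<in> W") (auto simp: j_def indicator_def)
  qed
  have tW_le: "t * indicator W z \<le> k z" and jg_le: "j z - g z \<le> k z" for z
    unfolding k_def using gj[of z] tW[of z] by auto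
  note int1 = integrable_bounded_mult
  have iW [measurable]: "indicator W \<in> borel_measurable \<pi>" by simp
  have bW: "\<bar>indicator W z :: real\<bar> \<le> 1" for z by (simp add: indicator_def)
  note ints = int1[OF integrable_snd g g1(2)] int1[OF integrable_fst g g1(2)]
    int1[OF integrable_snd j j01(3)] int1[OF integrable_fst j j01(3)]
    int1[OF integrable_snd iW bW]
  have one: "integrable \<pi> (\<lambda>_. 1 :: real)" by simp
  have ic: "integrable \<pi> j" "integrable \<pi> g" "integrable \<pi> (indicator W :: _ \<Rightarrow> real)"
    using int1[OF one j j01(3)] int1[OF one g g1(2)] int1[OF one iW bW] by simp_all
  have "(\<integral>z. g z * (c - snd z) \<partial>\<pi>) = 0"
    using balance[of "\<lambda>_. 1" 1] by simp
  then have gc: "(\<integral>z. g z * snd z \<partial>\<pi>) = c * (\<integral>z. g z \<partial>\<pi>)"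
    using ints ic by (simp add: algebra_simps)
  have Wc': "(\<integral>z. indicator W z * snd z \<partial>\<pi>) = c * prob W"
    using Wc ints ic by (simp add: algebra_simps)
  have jm: "(\<integral>z. j z * snd z \<partial>\<pi>) = (\<integral>z. j z * fst z \<partial>\<pi>)"
    using martingale_integral[OF jF j01(3)] ints by (simp add: algebra_simps)
  have kint: "integrable \<pi> (\<lambda>z. k z * snd z)"
    by (rule int1[OF integrable_snd, of _ 1]) (use k01 in auto)
  have "push j fst \<le>cx push k snd"
  proof (rule le_cxI_nonneg_convex)
    show "measure (push j fst) UNIV = measure (push k snd) UNIV"
      unfolding measure_push[OF j measurable_fst_\<pi> j01(1,2)] measure_push[OF kmeas measurable_snd_\<pi> k01]
      unfolding k_def using ic gt by simp
    have "(\<integral>z. k z * snd z \<partial>\<pi>) = (\<integral>z. j z * snd z - g z * snd z + t * (indicator W z * snd z) \<partial>\<pi>)"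
      unfolding k_def by (simp add: algebra_simps)
    also have "\<dots> = (\<integral>z. j z * fst z \<partial>\<pi>)"
      using ints jm gc Wc' gt by simp
    finally show "(\<integral>x. x \<partial>push j fst) = (\<integral>x. x \<partial>push k snd)"
      using j01(1) k01(1) by (simp add: integral_push)
  next
    fix \<phi> :: "real \<Rightarrow> real"
    assume cx: "convex_on UNIV \<phi>" and pos: "\<And>x. 0 \<le> \<phi> x" and int: "integrable (push k snd) \<phi>"
    note [measurable] = borel_measurable_convex_real[OF cx]
    obtain s where s: "mono s" "\<And>x y. \<phi> x + s x * (y - x) \<le> \<phi> y"
      using convex_real_supporting_lines[OF cx] by metis
    have [measurable]: "s \<in> borel_measurable borel"
      by (rule borel_measurable_mono[OF s(1)])
    have k\<phi>: "integrable \<pi> (\<lambda>z. k z * \<phi> (snd z))"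
      using int k01(1) by (simp add: integrable_push_iff)
    have dom: "integrable \<pi> (\<lambda>z. f z * \<phi> (snd z))"
      if "f \<in> borel_measurable \<pi>" "\<And>z. 0 \<le> f z" "\<And>z. f z \<le> k z" for f
      using that pos k01(1)
      by (intro Bochner_Integration.integrable_bound[OF k\<phi>]) (auto intro!: AE_I2 mult_right_mono simp: abs_mult)
    have i1: "integrable \<pi> (\<lambda>z. (j z - g z) * \<phi> (snd z))"
      by (rule dom) (use gj jg_le in auto)
    have i2: "integrable \<pi> (\<lambda>z. t * indicator W z * \<phi> (snd z))"
      by (rule dom) (use tW tW_le in auto)
    have iWc: "integrable \<pi> (\<lambda>z. indicator W z * (snd z - c))"
      using ints ic by (simp add: algebra_simps)
    \<comment> \<open>Jensen on \<open>W\<close>: its barycentre is \<open>c\<close>, so the slope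
      term integrates to zero, and the added mass, which equals the mass of \<open>g\<close>,
      contributes at least as much as if it sat at \<open>c\<close>.\<close>
    have "(\<integral>z. t * \<phi> c * indicator W z + t * s c * (indicator W z * (snd z - c)) \<partial>\<pi>)
        \<le> (\<integral>z. t * indicator W z * \<phi> (snd z) \<partial>\<pi>)"
    proof (rule integral_mono)
      show "integrable \<pi> (\<lambda>z. t * \<phi> c * indicator W z + t * s c * (indicator W z * (snd z - c)))"
        using iWc ic by (intro Bochner_Integration.integrable_add integrable_mult_right)
      show "t * \<phi> c * indicator W z + t * s c * (indicator W z * (snd z - c))
          \<le> t * indicator W z * \<phi> (snd z)" for z
        using mult_left_mono[OF s(2)[of c "snd z"] t(1)] by (auto simp: indicator_def algebra_simps)
    qed (rule i2)
    then have W\<phi>: "\<phi> c * (\<integral>z. g z \<partial>\<pi>) \<le> (\<integral>z. t * indicator W z * \<phi> (snd z) \<partial>\<pi>)"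
      using Wc ic iWc gt by (simp add: ac_simps)
    define J where "J n = (indicator {z. \<bar>fst z\<bar> \<le> real n \<and> fst z \<le> q} :: real \<times> real \<Rightarrow> real)" for n :: nat
    have J [measurable]: "J n \<in> borel_measurable F" for n
    proof -
      have "{z \<in> space F. \<bar>fst z\<bar> \<le> real n \<and> fst z \<le> q} \<in> sets F" by measurable
      then show ?thesis unfolding J_def by (simp add: space_F)
    qed
    have J\<pi> [measurable]: "J n \<in> borel_measurable \<pi>" for n
      by (rule measurable_F_\<pi>) simp
    have bound: "(\<integral>\<^sup>+z. ennreal (J n z * \<phi> (fst z)) \<partial>\<pi>) \<le> ennreal (\<integral>z. k z * \<phi> (snd z) \<partial>\<pi>)" for n
    proof -
      define C where "C = max \<bar>s (- real n)\<bar> \<bar>s (real n)\<bar>"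
      have sC: "\<bar>s x\<bar> \<le> C" if "\<bar>x\<bar> \<le> real n" for x
      proof -
        have "s (- real n) \<le> s x" "s x \<le> s (real n)"
          using that by (auto intro!: monoD[OF s(1)])
        then show ?thesis unfolding C_def by auto
      qed
      define Z where "Z z = J n z * s (fst z)" for z
      have ZC: "\<bar>Z z\<bar> \<le> C" for z
        using sC[of "fst z"] sC[of 0] unfolding Z_def J_def by (auto simp: indicator_def)
      have ZF [measurable]: "Z \<in> borel_measurable F" unfolding Z_def by measurable
      have Z\<pi>: "Z \<in> borel_measurable \<pi>" by (rule measurable_F_\<pi>) fact
      have T: "(\<integral>z. Z z * (snd z - fst z) \<partial>\<pi>) = 0" "(\<integral>z. Z z * (g z * (c - snd z)) \<partial>\<pi>) = 0"
        using martingale_integral[OF ZF ZC] balance[OF ZF ZC] by auto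
      have Ti: "integrable \<pi> (\<lambda>z. Z z * (snd z - fst z))" "integrable \<pi> (\<lambda>z. Z z * (g z * (c - snd z)))"
      proof -
        have "integrable \<pi> (\<lambda>z. snd z - fst z)" "integrable \<pi> (\<lambda>z. g z * (c - snd z))"
          using ints ic integrable_fst integrable_snd by (simp_all add: algebra_simps)
        then show "integrable \<pi> (\<lambda>z. Z z * (snd z - fst z))" "integrable \<pi> (\<lambda>z. Z z * (g z * (c - snd z)))"
          by (auto intro!: int1[OF _ Z\<pi> ZC])
      qed
      \<comment> \<open>Integrability of \<phi> at the source is not known beforehand; on the
        truncation \<phi> is bounded, by evaluating the supporting line at the source in 0.\<close>
      have J\<phi>: "integrable \<pi> (\<lambda>z. J n z * \<phi> (fst z))"
      proof (rule integrable_const_bound[where B = "\<phi> 0 + C * real n"])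
        have "J n z * \<phi> (fst z) \<le> \<phi> 0 + C * real n" for z
        proof (cases "\<bar>fst z\<bar> \<le> real n")
          case True
          have "s (fst z) * fst z \<le> \<bar>s (fst z)\<bar> * \<bar>fst z\<bar>"
            by (metis abs_ge_self abs_mult)
          also have "\<dots> \<le> C * real n"
            using sC[OF True] True by (intro mult_mono) auto
          finally have "\<phi> (fst z) \<le> \<phi> 0 + C * real n"
            using s(2)[of "fst z" 0] by simp
          then show ?thesis using pos[of "fst z"] by (auto simp: J_def indicator_def)
        next
          case False
          have "0 \<le> C" using sC[of 0] by auto
          then show ?thesis using pos[of 0] False by (auto simp: J_def)
        qed
        moreover have "0 \<le> J n z * \<phi> (fst z)" for z
          using pos by (simp add: J_def)
        ultimately show "AE z in \<pi>. norm (J n z * \<phi> (fst z)) \<le> \<phi> 0 + C * real n"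
          by simp
      qed measurable
      \<comment> \<open>The line at \<open>x\<close> is evaluated at \<open>y\<close> with weight
        \<open>1 - g\<close> and at \<open>c\<close> with weight \<open>g\<close>. Since (1 - g)(y -
        x) + g(c - x) = (y - x) + g(c - y), the slope terms are those of \<open>T\<close> and
        integrate to zero.\<close>
      have pt: "J n z * \<phi> (fst z) + Z z * (snd z - fst z) + Z z * (g z * (c - snd z))
          \<le> (j z - g z) * \<phi> (snd z) + \<phi> c * g z" for z
      proof (cases "J n z = 1")
        case True
        then have "j z = 1" by (auto simp: J_def j_def indicator_def split: if_splits)
        have "(1 - g z) * (\<phi> (fst z) + s (fst z) * (snd z - fst z)) + g z * (\<phi> (fst z) + s (fst z) * (c - fst z))
            \<le> (1 - g z) * \<phi> (snd z) + g z * \<phi> c"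
          using s(2)[of "fst z"] g1(1)[of z] g01(1)[of z] by (intro add_mono mult_left_mono) auto
        then show ?thesis
          using True \<open>j z = 1\<close> by (simp add: Z_def algebra_simps)
      next
        case False
        then have "J n z = 0" by (auto simp: J_def indicator_def)
        then show ?thesis
          using gj[of z] g01(1)[of z] pos by (simp add: Z_def)
      qed
      have "(\<integral>z. J n z * \<phi> (fst z) \<partial>\<pi>)
          = (\<integral>z. J n z * \<phi> (fst z) + Z z * (snd z - fst z) + Z z * (g z * (c - snd z)) \<partial>\<pi>)"
        using J\<phi> Ti T by simp
      also have "\<dots> \<le> (\<integral>z. (j z - g z) * \<phi> (snd z) + \<phi> c * g z \<partial>\<pi>)"
        using J\<phi> Ti i1 ic by (intro integral_mono pt) auto
      also have "\<dots> \<le> (\<integral>z. (j z - g z) * \<phi> (snd z) \<partial>\<pi>) + (\<integral>z. t * indicator W z * \<phi> (snd z) \<partial>\<pi>)"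
        using i1 ic W\<phi> by simp
      also have "\<dots> = (\<integral>z. (j z - g z) * \<phi> (snd z) + t * indicator W z * \<phi> (snd z) \<partial>\<pi>)"
        using i1 i2 by simp
      also have "\<dots> = (\<integral>z. k z * \<phi> (snd z) \<partial>\<pi>)"
        unfolding k_def by (simp add: algebra_simps)
      finally show ?thesis
        using J\<phi> pos by (subst nn_integral_eq_integral) (auto simp: J_def intro!: ennreal_leI)
    qed
    have "(\<integral>\<^sup>+x. ennreal (\<phi> x) \<partial>push j fst) = (\<integral>\<^sup>+z. ennreal (j z * \<phi> (fst z)) \<partial>\<pi>)"
      using j01(1) by (simp add: nn_integral_push)
    also have "\<dots> = (\<integral>\<^sup>+z. (SUP n. ennreal (J n z * \<phi> (fst z))) \<partial>\<pi>)"
    proof (intro nn_integral_cong antisym SUP_least)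
      fix z :: "real \<times> real"
      obtain n where "\<bar>fst z\<bar> \<le> real n" using real_arch_simple by blast
      then have "j z = J n z" by (auto simp: j_def J_def indicator_def)
      then show "ennreal (j z * \<phi> (fst z)) \<le> (SUP n. ennreal (J n z * \<phi> (fst z)))"
        by (metis SUP_upper UNIV_I)
      show "ennreal (J n z * \<phi> (fst z)) \<le> ennreal (j z * \<phi> (fst z))" for n
        using pos by (auto intro!: ennreal_leI simp: j_def J_def indicator_def)
    qed
    also have "\<dots> = (SUP n. \<integral>\<^sup>+z. ennreal (J n z * \<phi> (fst z)) \<partial>\<pi>)"
      using pos by (intro nn_integral_monotone_convergence_SUP)
        (auto simp: incseq_def le_fun_def J_def indicator_def intro!: ennreal_leI)
    also have "\<dots> \<le> ennreal (\<integral>z. k z * \<phi> (snd z) \<partial>\<pi>)"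
      by (intro SUP_least bound)
    also have "\<dots> = (\<integral>\<^sup>+x. ennreal (\<phi> x) \<partial>push k snd)"
      using k\<phi> pos k01(1) by (simp add: nn_integral_push nn_integral_eq_integral)
    finally show "(\<integral>\<^sup>+x. ennreal (\<phi> x) \<partial>push j fst) \<le> (\<integral>\<^sup>+x. ennreal (\<phi> x) \<partial>push k snd)" .
  qed (use j01 k01 ints kint in \<open>auto intro!: finite_measure_push simp: sets_push integrable_push_iff\<close>)
  then show ?thesis
    unfolding k_def[abs_def] j_def .
qed


text \<open>By minimality the exchange cannot lower the integral of \<open>\<psi>\<close>, which
  forces the withdrawn mass to be zero. The weights of the withdrawal are positive where a source
  sends mass to both sides, so no such source is left. The conclusion is read at the points of
  \<pi>: a source seen to send mass to one side sends none to the other.\<close>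

lemma no_crossing_mass:
  assumes "a < b"
    and shadow: "\<And>k. k \<in> borel_measurable \<pi> \<Longrightarrow> (\<And>z. 0 \<le> k z) \<Longrightarrow> (\<And>z. k z \<le> 1) \<Longrightarrow>
      push (indicator {z. fst z \<le> q}) fst \<le>cx push k snd \<Longrightarrow>
      push (indicator {z. fst z \<le> q}) snd \<le>cx push k snd"
    and mass: "0 < prob {z. q < fst z \<and> a < snd z \<and> snd z < b}"
  shows "AE z in \<pi>. fst z \<le> q \<longrightarrow>
    (snd z \<le> a \<longrightarrow> E (indicator {z. b \<le> snd z}) z \<le> 0) \<and>
    (b \<le> snd z \<longrightarrow> E (indicator {z. snd z \<le> a}) z \<le> 0)"
proof -
  define W where "W = {z :: real \<times> real. q < fst z \<and> a < snd z \<and> snd z < b}"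
  define e where "e = prob W"
  have e: "0 < e" "e \<le> 1"
    using mass by (auto simp: e_def W_def)
  have setP: "{z. P z} \<in> sets \<pi>" if "Measurable.pred \<pi> P" for P
    using that by (simp add: pred_def space_eq)
  have W [measurable]: "W \<in> sets \<pi>"
    unfolding W_def by (rule setP) measurable
  have ind: "indicator {z. P z} \<in> borel_measurable \<pi>" "\<And>z. \<bar>indicator {z. P z} z :: real\<bar> \<le> 1"
    if "Measurable.pred \<pi> P" for P :: "real \<times> real \<Rightarrow> bool"
    using setP[OF that] by (auto simp: indicator_def)
  have iW: "indicator W \<in> borel_measurable \<pi>" "\<And>z. \<bar>indicator W z :: real\<bar> \<le> 1"
    using W by (auto simp: indicator_def)
  have iWi: "integrable \<pi> (indicator W :: _ \<Rightarrow> real)"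
    using W by (auto simp: less_top[symmetric] intro!: integrable_real_indicator)
  have iWs: "integrable \<pi> (\<lambda>z. indicator W z * snd z)"
    by (rule integrable_bounded_mult[OF integrable_snd iW])
  \<comment> \<open>The barycentre of \<open>W\<close>, strictly between \<open>a\<close> and
    \<open>b\<close> because \<open>W\<close> has positive mass.\<close>
  define c where "c = (\<integral>z. indicator W z * snd z \<partial>\<pi>) / e"
  have Wc: "(\<integral>z. indicator W z * (snd z - c) \<partial>\<pi>) = 0"
    using iWs iWi e(1) by (simp add: right_diff_distrib c_def e_def[symmetric])
  have ac: "a < c"
  proof -
    have "0 < (\<integral>z. indicator W z * (snd z - a) \<partial>\<pi>)"
      by (rule integral_pos[where W = W])
        (use iWs iWi e in \<open>auto simp: W_def[symmetric] e_def right_diff_distrib, auto simp: W_def indicator_def\<close>)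
    then have "0 < (\<integral>z. indicator W z * snd z \<partial>\<pi>) - a * e"
      using iWs iWi by (simp add: right_diff_distrib e_def mult.commute)
    then show ?thesis using e(1) by (simp add: c_def field_simps)
  qed
  have cb: "c < b"
  proof -
    have "0 < (\<integral>z. indicator W z * (b - snd z) \<partial>\<pi>)"
      by (rule integral_pos[where W = W])
        (use iWs iWi e in \<open>auto simp: W_def[symmetric] e_def right_diff_distrib, auto simp: W_def indicator_def\<close>)
    then have "0 < b * e - (\<integral>z. indicator W z * snd z \<partial>\<pi>)"
      using iWs iWi by (simp add: right_diff_distrib e_def mult.commute)
    then show ?thesis using e(1) by (simp add: c_def field_simps)
  qed
  define ia ib :: "real \<times> real \<Rightarrow> real" where "ia = indicator {z. snd z \<le> a}" and "ib = indicator {z. b \<le> snd z}"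
  have ia [measurable]: "ia \<in> borel_measurable \<pi>" "\<bar>ia z\<bar> \<le> 1" and ib [measurable]: "ib \<in> borel_measurable \<pi>" "\<bar>ib z\<bar> \<le> 1" for z
    unfolding ia_def ib_def by (auto intro!: ind)
  \<comment> \<open>Distances to \<open>c\<close> on the parts below \<open>a\<close> and above
    \<open>b\<close>, nonnegative because \<open>a < c < b\<close>; a balanced withdrawal has to
    equate their weighted conditional means.\<close>
  define fu fv where "fu z = ia z * (c - snd z)" and "fv z = ib z * (snd z - c)" for z
  have int_sc: "integrable \<pi> (\<lambda>z. c - snd z)" "integrable \<pi> (\<lambda>z. snd z - c)"
    using integrable_snd by auto
  have fui: "integrable \<pi> fu" unfolding fu_def[abs_def]
    by (rule integrable_bounded_mult[OF int_sc(1) ia])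
  have fvi: "integrable \<pi> fv" unfolding fv_def[abs_def]
    by (rule integrable_bounded_mult[OF int_sc(2) ib])
  have fpos: "0 \<le> fu z" "0 \<le> fv z" for z
    using ac cb by (auto simp: fu_def fv_def ia_def ib_def indicator_def)
  define u v where "u = E fu" and "v = E fv"
  have [measurable]: "u \<in> borel_measurable F" "v \<in> borel_measurable F"
    unfolding u_def v_def by simp_all
  have uv0: "AE z in \<pi>. 0 \<le> u z" "AE z in \<pi>. 0 \<le> v z"
    unfolding u_def v_def using fui fvi fpos by (auto intro!: real_cond_exp_pos)
  \<comment> \<open>Weights with \<open>A * u = B * v\<close>, so that \<open>A\<close> times the mass below \<open>a\<close> and \<open>B\<close> times the mass
    above \<open>b\<close> balance around \<open>c\<close>; the denominator only makes them bounded.\<close>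
  define A B where "A z = \<bar>v z\<bar> / (1 + \<bar>u z\<bar> + \<bar>v z\<bar>)" and "B z = \<bar>u z\<bar> / (1 + \<bar>u z\<bar> + \<bar>v z\<bar>)" for z
  have [measurable]: "A \<in> borel_measurable F" "B \<in> borel_measurable F"
    unfolding A_def B_def by measurable
  have AB\<pi> [measurable]: "A \<in> borel_measurable \<pi>" "B \<in> borel_measurable \<pi>"
    by (rule measurable_F_\<pi>, simp)+
  have AB: "0 \<le> A z" "A z \<le> 1" "0 \<le> B z" "B z \<le> 1" for z
    unfolding A_def B_def by (auto simp: divide_simps)
  define j :: "real \<times> real \<Rightarrow> real" where "j = indicator {z. fst z \<le> q}"
  have jF [measurable]: "j \<in> borel_measurable F"
  proof -
    have "{z \<in> space F. fst z \<le> q} \<in> sets F" by measurable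
    then show ?thesis unfolding j_def by (simp add: space_F)
  qed
  have j\<pi> [measurable]: "j \<in> borel_measurable \<pi>" by (rule measurable_F_\<pi>) simp
  have j01: "0 \<le> j z" "j z \<le> 1" for z by (auto simp: j_def indicator_def)
  define g0 where "g0 z = j z * (A z * ia z + B z * ib z)" for z
  have g0 [measurable]: "g0 \<in> borel_measurable \<pi>" unfolding g0_def by measurable
  have g0_01: "0 \<le> g0 z" "g0 z \<le> j z" for z
    using AB[of z] \<open>a < b\<close> by (auto simp: g0_def j_def ia_def ib_def indicator_def)
  then have g0_1: "\<bar>g0 z\<bar> \<le> 1" for z using j01[of z] g0_01[of z] by linarith
  define t where "t = (\<integral>z. g0 z \<partial>\<pi>)"
  have g0i: "integrable \<pi> g0"
    by (rule integrable_const_bound[where B = 1]) (use g0_1 in auto)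
  have t: "0 \<le> t" "t \<le> 1"
  proof -
    show "0 \<le> t" unfolding t_def by (intro Bochner_Integration.integral_nonneg g0_01)
    have "t \<le> (\<integral>z. 1 \<partial>\<pi>)"
      unfolding t_def using g0_1 by (intro integral_mono g0i) (auto simp: abs_le_iff)
    then show "t \<le> 1" by (simp add: prob_space)
  qed
  \<comment> \<open>The factor \<open>e = prob W\<close> gives \<open>g\<close> the mass
    \<open>t * e\<close>. This is exactly the mass of the density \<open>t\<close> on
    \<open>W\<close>, and \<open>t \<le> 1\<close> keeps \<open>k\<close> within [0, 1].\<close>
  define g where "g z = e * g0 z" for z
  have gle: "0 \<le> g z" "g z \<le> j z" for z
  proof -
    show "0 \<le> g z" unfolding g_def using e g0_01 by simp
    have "e * g0 z \<le> 1 * g0 z" by (intro mult_right_mono e g0_01)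
    then show "g z \<le> j z" unfolding g_def using g0_01(2)[of z] by simp
  qed
  have balance: "(\<integral>z. Z z * (g z * (c - snd z)) \<partial>\<pi>) = 0"
    if [measurable]: "Z \<in> borel_measurable F" and ZC: "\<And>z. \<bar>Z z\<bar> \<le> C" for Z C
  proof -
    \<comment> \<open>Conditioning replaces \<open>fu\<close> and \<open>fv\<close> by
      \<open>u\<close> and \<open>v\<close>, for which \<open>A * u = B * v\<close> almost
      everywhere.\<close>
    define ZA ZB where "ZA z = Z z * j z * A z" and "ZB z = Z z * j z * B z" for z
    have Zm: "ZA \<in> borel_measurable F" "ZB \<in> borel_measurable F"
      unfolding ZA_def ZB_def by measurable
    have "0 \<le> C" using ZC[of undefined] by linarith
    have Zj: "\<bar>Z z * j z\<bar> \<le> C" for z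
      using ZC[of z] \<open>0 \<le> C\<close> by (auto simp: j_def indicator_def)
    have Zb: "\<bar>ZA z\<bar> \<le> C * 1" "\<bar>ZB z\<bar> \<le> C * 1" for z
      unfolding ZA_def ZB_def abs_mult[of _ "A z"] abs_mult[of _ "B z"]
      using AB[of z] \<open>0 \<le> C\<close> by (intro mult_mono Zj; simp)+
    note int = integrable_bounded_mult[OF fui measurable_F_\<pi>[OF Zm(1)] Zb(1)]
      integrable_bounded_mult[OF fvi measurable_F_\<pi>[OF Zm(2)] Zb(2)]
    have "(\<integral>z. ZA z * fu z \<partial>\<pi>) = (\<integral>z. ZA z * u z \<partial>\<pi>)"
      unfolding u_def by (rule cond_exp_bounded_factor[OF fui Zm(1) Zb(1)])
    also have "\<dots> = (\<integral>z. ZB z * v z \<partial>\<pi>)"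
    proof (rule integral_cong_AE)
      show "AE z in \<pi>. ZA z * u z = ZB z * v z"
        using uv0 by eventually_elim (simp add: ZA_def ZB_def A_def B_def)
    qed (auto intro!: measurable_F_\<pi> borel_measurable_times Zm)
    also have "\<dots> = (\<integral>z. ZB z * fv z \<partial>\<pi>)"
      unfolding v_def by (rule cond_exp_bounded_factor[OF fvi Zm(2) Zb(2), symmetric])
    finally have "(\<integral>z. e * (ZA z * fu z - ZB z * fv z) \<partial>\<pi>) = 0"
      using int by simp
    moreover have "Z z * (g z * (c - snd z)) = e * (ZA z * fu z - ZB z * fv z)" for z
      by (simp add: g_def g0_def ZA_def ZB_def fu_def fv_def algebra_simps)
    ultimately show ?thesis by simp
  qed
  define k where "k z = j z - g z + t * indicator W z" for z
  have k01: "0 \<le> k z" "k z \<le> 1" for z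
  proof -
    show "0 \<le> k z" unfolding k_def using gle[of z] t by simp
    show "k z \<le> 1" unfolding k_def using gle[of z] t
      by (cases "z \<in> W") (auto simp: j_def W_def indicator_def)
  qed
  have [measurable]: "g \<in> borel_measurable \<pi>" unfolding g_def by measurable
  have [measurable]: "k \<in> borel_measurable \<pi>"
    unfolding k_def by measurable
  have "push (indicator {z. fst z \<le> q}) fst \<le>cx push k snd"
    unfolding k_def[abs_def] j_def
  proof (rule modified_marginal_le_cx)
    show "(\<integral>z. g z \<partial>\<pi>) = t * prob W"
      by (simp add: g_def t_def e_def)
    show "g z \<le> indicator {z. fst z \<le> q} z" for z
      using gle(2) unfolding j_def .
    show "W \<subseteq> {z. q < fst z}"
      by (auto simp: W_def)
    show "(\<integral>z. Z z * (g z * (c - snd z)) \<partial>\<pi>) = 0"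
      if "Z \<in> borel_measurable F" "\<And>z. \<bar>Z z\<bar> \<le> C" for Z C
      by (rule balance[OF that])
  qed (simp_all add: gle t Wc)
  then have cx: "push j snd \<le>cx push k snd"
    unfolding j_def using k01 by (intro shadow) auto
  define \<psi> where "\<psi> y = dist ((a + b) / 2) y + - ((b - a) / 2)" for y :: real
  have \<psi>cx: "convex_on UNIV \<psi>"
    unfolding \<psi>_def[abs_def] by (intro convex_on_add convex_on_dist) (auto simp: convex_on_const)
  have [measurable]: "\<psi> \<in> borel_measurable borel"
    by (rule borel_measurable_convex_real[OF \<psi>cx])
  have \<psi>_int: "integrable \<pi> (\<lambda>z. \<psi> (snd z))"
    unfolding \<psi>_def dist_real_def using integrable_snd by auto
  have \<psi>_out: "0 \<le> \<psi> y" if "y \<le> a \<or> b \<le> y" for y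
    using that \<open>a < b\<close> unfolding \<psi>_def dist_real_def by (auto simp: abs_if field_simps)
  have \<psi>_in: "\<psi> y < 0" if "a < y" "y < b" for y
    using that unfolding \<psi>_def dist_real_def by (auto simp: abs_if field_simps)
  have ji: "integrable \<pi> (\<lambda>z. j z * \<psi> (snd z))"
    by (rule integrable_bounded_mult[OF \<psi>_int, of _ 1]) (use j01 in auto)
  have gi: "integrable \<pi> (\<lambda>z. g0 z * \<psi> (snd z))"
    by (rule integrable_bounded_mult[OF \<psi>_int, of _ 1]) (use g0_1 in auto)
  have Wi: "integrable \<pi> (\<lambda>z. indicator W z * \<psi> (snd z))"
    by (rule integrable_bounded_mult[OF \<psi>_int iW])
  have k_split: "k z * \<psi> (snd z) = j z * \<psi> (snd z) - e * (g0 z * \<psi> (snd z)) + t * (indicator W z * \<psi> (snd z))" for z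
    by (simp add: k_def g_def algebra_simps)
  have "ext_integral (push j snd) \<psi> \<le> ext_integral (push k snd) \<psi>"
    using cx \<psi>cx unfolding le_cx_def by blast
  then have "(\<integral>z. j z * \<psi> (snd z) \<partial>\<pi>) \<le> (\<integral>z. k z * \<psi> (snd z) \<partial>\<pi>)"
    using j01 k01 ji gi Wi
    by (subst (asm) (1 2) ext_integral_eq_integral) (auto simp: integrable_push_iff integral_push k_split)
  then have "e * (\<integral>z. g0 z * \<psi> (snd z) \<partial>\<pi>) \<le> t * (\<integral>z. indicator W z * \<psi> (snd z) \<partial>\<pi>)"
    using ji gi Wi by (simp add: k_split)
  moreover have "0 \<le> (\<integral>z. g0 z * \<psi> (snd z) \<partial>\<pi>)"
  proof (rule Bochner_Integration.integral_nonneg)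
    show "0 \<le> g0 z * \<psi> (snd z)" for z
      using g0_01(1)[of z] \<psi>_out[of "snd z"]
      by (cases "snd z \<le> a \<or> b \<le> snd z") (auto simp: g0_def ia_def ib_def indicator_def)
  qed
  moreover have "0 < (\<integral>z. - (indicator W z * \<psi> (snd z)) \<partial>\<pi>)"
  proof (rule integral_pos[where W = W])
    show "0 \<le> - (indicator W z * \<psi> (snd z))" "z \<in> W \<Longrightarrow> 0 < - (indicator W z * \<psi> (snd z))" for z
      using \<psi>_in[of "snd z"] by (auto simp: W_def indicator_def)
  qed (use Wi e in \<open>auto simp: e_def\<close>)
  ultimately have *: "e * (\<integral>z. g0 z * \<psi> (snd z) \<partial>\<pi>) \<le> t * (\<integral>z. indicator W z * \<psi> (snd z) \<partial>\<pi>)"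
    "0 \<le> (\<integral>z. g0 z * \<psi> (snd z) \<partial>\<pi>)" "(\<integral>z. indicator W z * \<psi> (snd z) \<partial>\<pi>) < 0"
    by simp_all
  \<comment> \<open>\<open>\<psi>\<close> is nonnegative where \<open>g0\<close> takes mass and has
    a negative integral over \<open>W\<close>, so the inequality leaves no room for a positive
    \<open>t\<close>.\<close>
  have "0 \<le> e * (\<integral>z. g0 z * \<psi> (snd z) \<partial>\<pi>)"
    using e(1) *(2) by simp
  then have "0 \<le> t * (\<integral>z. indicator W z * \<psi> (snd z) \<partial>\<pi>)"
    using *(1) by linarith
  then have "t = 0"
    using t(1) *(3) by (auto simp: zero_le_mult_iff)
  then have "AE z in \<pi>. g0 z = 0"
    using g0i g0_01 unfolding t_def by (subst (asm) integral_nonneg_eq_0_iff_AE) auto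
  \<comment> \<open>\<open>g0 = 0\<close> kills the weight \<open>A\<close> at points below
    \<open>a\<close> and \<open>B\<close> at points above \<open>b\<close>; \<open>A\<close>
    vanishes only with \<open>v\<close>, and \<open>B\<close> only with \<open>u\<close>.\<close>
  then have zero: "AE z in \<pi>. fst z \<le> q \<longrightarrow> (snd z \<le> a \<longrightarrow> v z \<le> 0) \<and> (b \<le> snd z \<longrightarrow> u z \<le> 0)"
  proof eventually_elim
    case (elim z)
    have "v z = 0" if "A z = 0" using that by (auto simp: A_def divide_simps split: if_splits)
    moreover have "u z = 0" if "B z = 0" using that by (auto simp: B_def divide_simps split: if_splits)
    ultimately show ?case
      using elim \<open>a < b\<close> by (auto simp: g0_def j_def ia_def ib_def)
  qed
  have intab: "integrable \<pi> ia" "integrable \<pi> ib"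
    by (rule integrable_const_bound[where B = 1]; use ia ib in auto)+
  have setF: "{z. f z \<le> 0} \<in> sets F" if [measurable]: "f \<in> borel_measurable F" for f :: "real \<times> real \<Rightarrow> real"
  proof -
    have "{z \<in> space F. f z \<le> 0} \<in> sets F" by measurable
    then show ?thesis by (simp add: space_F)
  qed
  \<comment> \<open>From moments back to mass: \<open>fv\<close> is positive at every target at or
    above \<open>b\<close> because \<open>c < b\<close>, so a vanishing moment leaves no mass there;
    likewise \<open>fu\<close> at or below \<open>a\<close>.\<close>
  have "AE z in \<pi>. z \<in> {z. v z \<le> 0} \<longrightarrow> fv z = 0"
    by (rule eq_0_on_cond_exp_le_0) (auto simp: fvi fpos v_def intro!: setF)
  then have "AE z in \<pi>. z \<in> {z. v z \<le> 0} \<longrightarrow> ib z = 0"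
    by eventually_elim (use cb in \<open>auto simp: fv_def ib_def indicator_def\<close>)
  then have "AE z in \<pi>. z \<in> {z. v z \<le> 0} \<longrightarrow> E ib z \<le> 0"
    by (intro cond_exp_le_0_on setF intab) (auto simp: ib_def)
  moreover have "AE z in \<pi>. z \<in> {z. u z \<le> 0} \<longrightarrow> fu z = 0"
    by (rule eq_0_on_cond_exp_le_0) (auto simp: fui fpos u_def intro!: setF)
  then have "AE z in \<pi>. z \<in> {z. u z \<le> 0} \<longrightarrow> ia z = 0"
    by eventually_elim (use ac in \<open>auto simp: fu_def ia_def indicator_def\<close>)
  then have "AE z in \<pi>. z \<in> {z. u z \<le> 0} \<longrightarrow> E ia z \<le> 0"
    by (intro cond_exp_le_0_on setF intab) (auto simp: ia_def)
  ultimately show ?thesis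
    using zero by eventually_elim (auto simp: ia_def ib_def)
qed


subsection \<open>The left-monotone support\<close>

definition crosses :: "real \<Rightarrow> real \<Rightarrow> real \<Rightarrow> bool" where
  "crosses q a b \<longleftrightarrow> 0 < prob {z. q < fst z \<and> a < snd z \<and> snd z < b}"

text \<open>The first condition says that rational windows around the point are charged, so that any
  point of the set can itself witness \<open>crosses\<close>. The second collects the exclusions of
  \<open>no_crossing_mass\<close>; the last two give mass strictly below and strictly above the
  source.\<close>

definition monotone_support :: "(real \<times> real) set" where
  "monotone_support = {z.
    (\<forall>q a b :: rat. of_rat q < fst z \<and> of_rat a < snd z \<and> snd z < of_rat b \<longrightarrow>
      crosses (of_rat q) (of_rat a) (of_rat b)) \<and>
    (\<forall>q a b :: rat. a < b \<and> crosses (of_rat q) (of_rat a) (of_rat b) \<and> fst z \<le> of_rat q \<longrightarrow>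
      (snd z \<le> of_rat a \<longrightarrow> E (indicator {z. of_rat b \<le> snd z}) z \<le> 0) \<and>
      (of_rat b \<le> snd z \<longrightarrow> E (indicator {z. snd z \<le> of_rat a}) z \<le> 0)) \<and>
    (\<exists>a :: rat. of_rat a < fst z \<and> 0 < E (indicator {z. snd z \<le> of_rat a}) z) \<and>
    (\<exists>b :: rat. fst z < of_rat b \<and> 0 < E (indicator {z. of_rat b \<le> snd z}) z)}"

lemma crosses_if_monotone_support:
  assumes "z \<in> monotone_support" "of_rat q < fst z" "of_rat a < snd z" "snd z < of_rat b"
  shows "crosses (of_rat q) (of_rat a) (of_rat b)"
  using assms unfolding monotone_support_def by blast

lemma
  assumes "z \<in> monotone_support" "crosses (of_rat q) (of_rat a) (of_rat b)" "a < b" "fst z \<le> of_rat q"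
  shows no_mass_above: "snd z \<le> of_rat a \<Longrightarrow> E (indicator {z. of_rat b \<le> snd z}) z \<le> 0"
    and no_mass_below: "of_rat b \<le> snd z \<Longrightarrow> E (indicator {z. snd z \<le> of_rat a}) z \<le> 0"
  using assms unfolding monotone_support_def by blast+

text \<open>\<open>l\<close> is a rational level below \<open>x\<close> to which \<open>x\<close>
  sends mass. A point with source right of \<open>x\<close> and target in \<open>(l, y)\<close>
  would charge a window ending before \<open>y\<close>, and then \<open>x\<close>, having
  \<open>y\<close> as a target, could not send mass to or below \<open>l\<close>.\<close>

lemma monotone_support_up:
  assumes z: "(x, y) \<in> monotone_support" and "x \<le> y"
  shows "\<exists>l<x. \<forall>x' y'. (x', y') \<in> monotone_support \<and> x < x' \<longrightarrow> y' \<notin> {l<..<y}"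
proof -
  obtain a :: rat where a: "of_rat a < x" "0 < E (indicator {z. snd z \<le> of_rat a}) (x, y)"
    using z unfolding monotone_support_def by auto
  have False if "(x', y') \<in> monotone_support" "x < x'" "of_rat a < y'" "y' < y" for x' y'
  proof -
    obtain b where b: "y' < of_rat b" "of_rat b < y"
      using of_rat_dense \<open>y' < y\<close> by blast
    obtain q where q: "x < of_rat q" "of_rat q < x'"
      using of_rat_dense \<open>x < x'\<close> by blast
    have "crosses (of_rat q) (of_rat a) (of_rat b)"
      using crosses_if_monotone_support[OF that(1)] that b q by simp
    moreover have "a < b"
      using that b by (metis less_trans of_rat_less)
    ultimately have "E (indicator {z. snd z \<le> of_rat a}) (x, y) \<le> 0"
      using no_mass_below[OF z] b q by simp
    with a show False by simp
  qed
  then show ?thesis using a(1) by auto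
qed

lemma monotone_support_down:
  assumes z: "(x, y) \<in> monotone_support" and "y \<le> x"
  shows "\<exists>u>x. \<forall>x' y'. (x', y') \<in> monotone_support \<and> x < x' \<longrightarrow> y' \<notin> {y<..<u}"
proof -
  obtain b :: rat where b: "x < of_rat b" "0 < E (indicator {z. of_rat b \<le> snd z}) (x, y)"
    using z unfolding monotone_support_def by auto
  have False if "(x', y') \<in> monotone_support" "x < x'" "y < y'" "y' < of_rat b" for x' y'
  proof -
    obtain a where a: "y < of_rat a" "of_rat a < y'"
      using of_rat_dense \<open>y < y'\<close> by blast
    obtain q where q: "x < of_rat q" "of_rat q < x'"
      using of_rat_dense \<open>x < x'\<close> by blast
    have "crosses (of_rat q) (of_rat a) (of_rat b)"
      using crosses_if_monotone_support[OF that(1)] that a q by simp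
    moreover have "a < b"
      using that a by (metis less_trans of_rat_less)
    ultimately have "E (indicator {z. of_rat b \<le> snd z}) (x, y) \<le> 0"
      using no_mass_above[OF z] a q by simp
    with b show False by simp
  qed
  then show ?thesis using b(1) by auto
qed

text \<open>The premise selects the moving sources, since \<open>mass_on_both_sides\<close> speaks
  of these.\<close>

lemma AE_monotone_support:
  assumes shadow: "\<And>q k. k \<in> borel_measurable \<pi> \<Longrightarrow> (\<And>z. 0 \<le> k z) \<Longrightarrow> (\<And>z. k z \<le> 1) \<Longrightarrow>
      push (indicator {z. fst z \<le> q}) fst \<le>cx push k snd \<Longrightarrow>
      push (indicator {z. fst z \<le> q}) snd \<le>cx push k snd"
  shows "AE z in \<pi>. 0 < E (indicator {z. snd z \<noteq> fst z}) z \<longrightarrow> z \<in> monotone_support"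
proof -
  have "AE z in \<pi>. of_rat q < fst z \<and> of_rat a < snd z \<and> snd z < of_rat b \<longrightarrow>
      crosses (of_rat q) (of_rat a) (of_rat b)" for q a b :: rat
  proof (cases "crosses (of_rat q) (of_rat a) (of_rat b)")
    case False
    define W where "W = {z :: real \<times> real. of_rat q < fst z \<and> of_rat a < snd z \<and> snd z < of_rat b}"
    have "{z \<in> space \<pi>. of_rat q < fst z \<and> of_rat a < snd z \<and> snd z < of_rat b} \<in> sets \<pi>"
      by measurable
    then have "W \<in> null_sets \<pi>"
      using False unfolding crosses_def W_def
      by (auto simp: space_eq null_sets_def emeasure_eq_measure not_less measure_le_0_iff)
    from AE_not_in[OF this] show ?thesis
      by eventually_elim (auto simp: W_def)
  qed simp
  then have 1: "AE z in \<pi>. \<forall>q a b :: rat. of_rat q < fst z \<and> of_rat a < snd z \<and> snd z < of_rat b \<longrightarrow>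
      crosses (of_rat q) (of_rat a) (of_rat b)"
    by (intro AE_all_countable[THEN iffD2] allI)
  have "AE z in \<pi>. a < b \<and> crosses (of_rat q) (of_rat a) (of_rat b) \<and> fst z \<le> of_rat q \<longrightarrow>
      (snd z \<le> of_rat a \<longrightarrow> E (indicator {z. of_rat b \<le> snd z}) z \<le> 0) \<and>
      (of_rat b \<le> snd z \<longrightarrow> E (indicator {z. snd z \<le> of_rat a}) z \<le> 0)" for q a b :: rat
  proof (cases "a < b \<and> crosses (of_rat q) (of_rat a) (of_rat b)")
    case True
    then have ab: "of_rat a < (of_rat b :: real)"
      and mass: "0 < prob {z. of_rat q < fst z \<and> of_rat a < snd z \<and> snd z < of_rat b}"
      by (simp_all add: of_rat_less crosses_def)
    have "AE z in \<pi>. fst z \<le> of_rat q \<longrightarrow>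
        (snd z \<le> of_rat a \<longrightarrow> E (indicator {z. of_rat b \<le> snd z}) z \<le> 0) \<and>
        (of_rat b \<le> snd z \<longrightarrow> E (indicator {z. snd z \<le> of_rat a}) z \<le> 0)"
      by (rule no_crossing_mass[OF ab _ mass]) (rule shadow)
    then show ?thesis by eventually_elim blast
  qed auto
  then have 2: "AE z in \<pi>. \<forall>q a b :: rat. a < b \<and> crosses (of_rat q) (of_rat a) (of_rat b) \<and> fst z \<le> of_rat q \<longrightarrow>
      (snd z \<le> of_rat a \<longrightarrow> E (indicator {z. of_rat b \<le> snd z}) z \<le> 0) \<and>
      (of_rat b \<le> snd z \<longrightarrow> E (indicator {z. snd z \<le> of_rat a}) z \<le> 0)"
    by (intro AE_all_countable[THEN iffD2] allI)
  show ?thesis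
    using 1 2 mass_on_both_sides[of 1, simplified] mass_on_both_sides[of "-1", simplified]
  proof eventually_elim
    case (elim z)
    then show ?case
      unfolding monotone_support_def mem_Collect_eq by (intro impI conjI) simp_all
  qed
qed

text \<open>\<open>A\<close> collects the sources that stay put and \<open>C\<close> the targets
  shared inside \<open>monotone_support\<close>; among the remaining pairs the target determines the
  source.\<close>

lemma graph_or_diagonal:
  assumes shadow: "\<And>q k. k \<in> borel_measurable \<pi> \<Longrightarrow> (\<And>z. 0 \<le> k z) \<Longrightarrow> (\<And>z. k z \<le> 1) \<Longrightarrow>
      push (indicator {z. fst z \<le> q}) fst \<le>cx push k snd \<Longrightarrow>
      push (indicator {z. fst z \<le> q}) snd \<le>cx push k snd"
  obtains h A C where "h \<in> borel_measurable borel" "A \<in> sets borel" "countable C"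
    "AE z in \<pi>. fst z \<in> A \<longrightarrow> snd z = fst z"
    "AE z in \<pi>. fst z \<notin> A \<and> snd z \<notin> C \<longrightarrow> h (snd z) = fst z"
proof -
  define w where "w = E (indicator {z. snd z \<noteq> fst z})"
  have wF [measurable]: "w \<in> borel_measurable F" unfolding w_def by simp
  have w\<pi> [measurable]: "w \<in> borel_measurable \<pi>" by (rule measurable_F_\<pi>) simp
  have "{z \<in> space F. w z \<le> 0} \<in> sets F" by measurable
  then have NF: "{z. w z \<le> 0} \<in> sets F" by (simp add: space_F)
  then obtain A where A: "A \<in> sets borel" "{z. w z \<le> 0} = fst -` A"
    unfolding sets_F_iff by blast
  have wA: "w z \<le> 0 \<longleftrightarrow> fst z \<in> A" for z using A(2) by auto
  have "AE z in \<pi>. z \<in> {z. w z \<le> 0} \<longrightarrow> (indicator {z. snd z \<noteq> fst z} z :: real) = 0"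
    by (rule eq_0_on_cond_exp_le_0) (auto simp: w_def intro!: integrable_real_pred NF[unfolded w_def])
  then have diag: "AE z in \<pi>. fst z \<in> A \<longrightarrow> snd z = fst z"
    by eventually_elim (auto simp: wA indicator_def split: if_splits)
  define C where "C = {y. \<exists>x x'. x < x' \<and> (x, y) \<in> monotone_support \<and> (x', y) \<in> monotone_support}"
  have C: "countable C"
    unfolding C_def using monotone_support_up monotone_support_down by (rule countable_shared_targets)
  have "AE z in \<pi>. 0 < w z \<longrightarrow> z \<in> monotone_support"
    unfolding w_def by (rule AE_monotone_support[OF shadow])
  then obtain N where N: "N \<in> null_sets \<pi>" "{z. \<not> (0 < w z \<longrightarrow> z \<in> monotone_support)} \<subseteq> N"
    by (auto simp: eventually_ae_filter space_eq)
  \<comment> \<open>Borel by construction, and contained in \<open>monotone_support\<close> once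
    \<open>N\<close> is removed; avoiding \<open>C\<close> makes \<open>snd\<close> injective on
    it.\<close>
  define G where "G = {z. 0 < w z \<and> snd z \<notin> C} - N"
  have [measurable]: "C \<in> sets borel"
    by (rule sets.countable[OF _ C]) simp
  have "{z \<in> space \<pi>. 0 < w z \<and> snd z \<notin> C} \<in> sets \<pi>" by measurable
  then have "G \<in> sets borel"
    unfolding G_def using N(1) by (auto simp: space_eq sets_eq)
  moreover have "inj_on snd G"
  proof (rule inj_onI)
    fix z z' assume "z \<in> G" "z' \<in> G" "snd z = snd z'"
    moreover from this have "z \<in> monotone_support" "z' \<in> monotone_support" "snd z \<notin> C"
      using N(2) unfolding G_def by auto
    ultimately show "z = z'"
      unfolding C_def by (cases z; cases z'; cases "fst z" "fst z'" rule: linorder_cases) auto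
  qed
  ultimately obtain h where h: "h \<in> borel_measurable borel" "AE z in \<pi>. z \<in> G \<longrightarrow> h (snd z) = fst z"
    using graph_function_of_inj_snd[OF finite_measure_axioms sets_eq] by metis
  have "AE z in \<pi>. fst z \<notin> A \<and> snd z \<notin> C \<longrightarrow> h (snd z) = fst z"
    using h(2) AE_not_in[OF N(1)]
    by eventually_elim (use wA in \<open>auto simp: G_def not_le[symmetric]\<close>)
  with h(1) A(1) C diag show ?thesis using that by blast
qed

section \<open>Comparison of the marginals on the sources that stay put\<close>

lemma AE_source_of_diagonal_target:
  assumes [measurable]: "A \<in> sets borel" and diag: "AE z in \<pi>. fst z \<in> A \<longrightarrow> snd z = fst z"
    and le: "emeasure (distr \<pi> borel snd) A \<le> emeasure (distr \<pi> borel fst) A"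
  shows "AE z in \<pi>. snd z \<in> A \<longrightarrow> fst z \<in> A"
proof -
  have m: "snd -` A \<in> events" "fst -` A \<in> events"
    using measurable_sets[OF measurable_snd_\<pi> assms(1)] measurable_sets[OF measurable_fst_\<pi> assms(1)]
    by (auto simp: space_eq)
  have "prob (snd -` A) \<le> prob (fst -` A)"
    using le by (simp add: emeasure_distr space_eq emeasure_eq_measure)
  also have "\<dots> = prob (snd -` A \<inter> fst -` A)"
    using diag m by (intro finite_measure_eq_AE) auto
  finally have "prob (snd -` A - snd -` A \<inter> fst -` A) = 0"
    using m finite_measure_mono[of "snd -` A \<inter> fst -` A" "snd -` A"]
    by (subst finite_measure_Diff) auto
  then have "AE z in \<pi>. z \<notin> snd -` A - snd -` A \<inter> fst -` A"
    using m by (subst (asm) prob_eq_0) auto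
  then show ?thesis by eventually_elim auto
qed

end

text \<open>Integrating the density over \<open>B\<close> gives 2 \<mu>(B) \<ge> \<mu>(B) +
  \<nu>(B), and finiteness allows \<mu>(B) to be cancelled.\<close>

lemma emeasure_le_of_RN_deriv_ge_half:
  fixes \<mu> \<nu> :: "'a measure"
  assumes "finite_measure \<mu>" "finite_measure \<nu>" and sets: "sets \<nu> = sets \<mu>"
    and B: "B \<in> sets \<mu>" and half: "\<And>x. x \<in> B \<Longrightarrow> 1 / 2 \<le> RN_deriv (plus_measure \<mu> \<nu>) \<mu> x"
  shows "emeasure \<nu> B \<le> emeasure \<mu> B"
proof -
  interpret \<mu>: finite_measure \<mu> by fact
  interpret \<nu>: finite_measure \<nu> by fact
  define c :: real where "c = 1 / 2"
  have c: "(1 / 2 :: ennreal) = ennreal c"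
    unfolding c_def by (metis divide_ennreal ennreal_1 ennreal_numeral zero_le_one zero_less_numeral zero_le_numeral)
  have c0: "0 \<le> c" by (simp add: c_def)
  define P where "P = plus_measure \<mu> \<nu>"
  have em: "emeasure P A = emeasure \<mu> A + emeasure \<nu> A" for A
    unfolding P_def by (rule emeasure_plus_measure[OF sets])
  have sP: "sets P = sets \<mu>" by (simp add: P_def)
  interpret P: finite_measure P
    by standard (simp add: em)
  have "absolutely_continuous P \<mu>"
    unfolding absolutely_continuous_def by (auto simp: null_sets_def em sP)
  then have "density P (RN_deriv P \<mu>) = \<mu>"
    by (rule P.density_RN_deriv) (simp add: sP)
  then have "emeasure \<mu> B = (\<integral>\<^sup>+x. RN_deriv P \<mu> x * indicator B x \<partial>P)"
    using B sP by (metis borel_measurable_RN_deriv emeasure_density)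
  also have "\<dots> \<ge> (\<integral>\<^sup>+x. ennreal c * indicator B x \<partial>P)"
    using half unfolding P_def c[symmetric] by (intro nn_integral_mono) (auto simp: indicator_def)
  also have "(\<integral>\<^sup>+x. ennreal c * indicator B x \<partial>P) = ennreal c * emeasure P B"
    using B sP by (simp add: nn_integral_cmult_indicator)
  finally have "ennreal (c * (measure \<mu> B + measure \<nu> B)) \<le> ennreal (measure \<mu> B)"
    by (simp add: em \<mu>.emeasure_eq_measure \<nu>.emeasure_eq_measure ennreal_mult c0)
  then have "c * (measure \<mu> B + measure \<nu> B) \<le> measure \<mu> B"
    by (simp add: ennreal_le_iff)
  then have "measure \<nu> B \<le> measure \<mu> B"
    by (simp add: c_def)
  then show ?thesis
    by (simp add: \<mu>.emeasure_eq_measure \<nu>.emeasure_eq_measure ennreal_leI)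
qed

subsection \<open>The left-curtain transport\<close>

lemma martingale_coupling_if_martingale_transport:
  assumes \<mu>: "\<mu> \<in> prob_finite_moment" and \<nu>: "\<nu> \<in> prob_finite_moment"
    and \<pi>: "\<pi> \<in> martingale_transports \<mu> \<nu>"
  shows "martingale_coupling \<pi>"
proof -
  have s: "sets \<pi> = sets borel" and d: "distr \<pi> borel fst = \<mu>" "distr \<pi> borel snd = \<nu>"
    and m: "AE z in \<pi>. real_cond_exp \<pi> (vimage_algebra (space \<pi>) fst borel) snd z = fst z"
    using \<pi> by (auto simp: martingale_transports_def)
  have meas [measurable]: "fst \<in> borel_measurable \<pi>" "snd \<in> borel_measurable \<pi>"
    using s by (auto simp: borel_prod[symmetric] cong: measurable_cong_sets)
  have "prob_space (distr \<pi> borel fst)"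
    using \<mu> unfolding d prob_finite_moment_def by simp
  then have "prob_space \<pi>"
    by (rule prob_space_distrD[rotated]) simp
  have "integrable (distr \<pi> borel fst) (\<lambda>x. x)" "integrable (distr \<pi> borel snd) (\<lambda>x. x)"
    using \<mu> \<nu> unfolding d prob_finite_moment_def by simp_all
  then have "integrable \<pi> fst" "integrable \<pi> snd"
    unfolding integrable_distr_eq[OF meas(1) measurable_ident_sets[OF refl]]
      integrable_distr_eq[OF meas(2) measurable_ident_sets[OF refl]] .
  with \<open>prob_space \<pi>\<close> s m show ?thesis
    unfolding martingale_coupling_def martingale_coupling_axioms_def by blast
qed

text \<open>Both restrictions in \<open>left_curtain\<close> are a \<open>push\<close> of the
  indicator of the sources up to \<open>q\<close>, and a density between 0 and 1 yields a measure
  below the second marginal. Minimality of the shadow thus supplies the hypothesis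
  \<open>shadow\<close> of the earlier lemmas.\<close>

lemma (in martingale_coupling) left_curtain_minimal:
  assumes lc: "left_curtain (distr \<pi> borel fst) (distr \<pi> borel snd) \<pi>"
    and k [measurable]: "k \<in> borel_measurable \<pi>" and k01: "\<And>z. 0 \<le> k z" "\<And>z. k z \<le> 1"
    and cx: "push (indicator {z. fst z \<le> q}) fst \<le>cx push k snd"
  shows "push (indicator {z. fst z \<le> q}) snd \<le>cx push k snd"
proof -
  have "restr_measure (distr \<pi> borel fst) {..q} = push (indicator {z. fst z \<le> q}) fst"
  proof -
    have "restr_measure (distr \<pi> borel fst) {..q} = distr (density \<pi> (\<lambda>z. indicator {..q} (fst z))) borel fst"
      unfolding restr_measure_def by (rule density_distr) auto
    also have "(\<lambda>z. indicator {..q} (fst z)) = (\<lambda>z :: real \<times> real. ennreal (indicator {z. fst z \<le> q} z))"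
      by (auto simp: indicator_def)
    finally show ?thesis unfolding push_def .
  qed
  moreover have "distr (restr_measure \<pi> ({..q} \<times> UNIV)) borel snd = push (indicator {z. fst z \<le> q}) snd"
  proof -
    have "indicator ({..q} \<times> UNIV) = (\<lambda>z :: real \<times> real. ennreal (indicator {z. fst z \<le> q} z))"
      by (auto simp: indicator_def)
    then show ?thesis unfolding push_def restr_measure_def by simp
  qed
  ultimately have "is_shadow (distr \<pi> borel snd) (push (indicator {z. fst z \<le> q}) fst)
      (push (indicator {z. fst z \<le> q}) snd)"
    using lc unfolding left_curtain_def by metis
  moreover have "push k snd \<in> shadow_competitors (distr \<pi> borel snd) (push (indicator {z. fst z \<le> q}) fst)"
  proof -
    have "integrable \<pi> (\<lambda>z. k z * snd z)"
      by (rule integrable_bounded_mult[OF integrable_snd k, of 1]) (use k01 in auto)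
    then show ?thesis
      using cx k01 by (auto simp: shadow_competitors_def finite_moment_measures_def sets_push
          integrable_push_iff intro!: finite_measure_push push_le)
  qed
  ultimately show ?thesis
    unfolding is_shadow_def by blast
qed

theorem proposition2p2:
  fixes \<mu> \<nu> :: "real measure" and \<pi> :: "(real \<times> real) measure"
  assumes "\<mu> \<in> prob_finite_moment" and "\<nu> \<in> prob_finite_moment"
    and "\<mu> \<le>cx \<nu>"
    and "left_curtain \<mu> \<nu> \<pi>"
  shows "(\<exists>h \<in> borel_measurable borel. measure \<pi> (S_rg h \<union> S_diag \<union> S_atom \<nu>) = 1) \<and>
    ((AE x in \<mu>. RN_deriv (plus_measure \<mu> \<nu>) \<mu> x \<ge> 1 / 2) \<longrightarrow>
       (\<exists>h \<in> borel_measurable borel. measure \<pi> (S_rg h \<union> S_atom \<nu>) = 1) \<and>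
       ((\<forall>y. measure \<nu> {y} = 0) \<longrightarrow> \<pi> \<in> monge_martingale_transports \<mu> \<nu>))"
proof -
  have \<mu>: "sets \<mu> = sets borel" "prob_space \<mu>" and \<nu>: "sets \<nu> = sets borel" "prob_space \<nu>"
    using assms(1,2) by (auto simp: prob_finite_moment_def)
  interpret \<mu>: prob_space \<mu> by fact
  interpret \<nu>: prob_space \<nu> by fact
  have transport: "\<pi> \<in> martingale_transports \<mu> \<nu>"
    using assms(4) by (simp add: left_curtain_def)
  interpret martingale_coupling \<pi>
    by (rule martingale_coupling_if_martingale_transport[OF assms(1,2) transport])
  have d: "distr \<pi> borel fst = \<mu>" "distr \<pi> borel snd = \<nu>"
    using transport by (auto simp: martingale_transports_def)
  have lc: "left_curtain (distr \<pi> borel fst) (distr \<pi> borel snd) \<pi>"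
    using assms(4) by (simp add: d)
  obtain h A C where [measurable]: "h \<in> borel_measurable borel" and A [measurable]: "A \<in> sets borel" and C: "countable C"
    and diag: "AE z in \<pi>. fst z \<in> A \<longrightarrow> snd z = fst z"
    and graph: "AE z in \<pi>. fst z \<notin> A \<and> snd z \<notin> C \<longrightarrow> h (snd z) = fst z"
    by (rule graph_or_diagonal) (rule left_curtain_minimal[OF lc])
  define D where "D = {y. 0 < measure \<nu> {y}}"
  have "countable D"
    using \<nu>.countable_support unfolding D_def by (rule countable_subset[rotated]) auto
  then have D [measurable]: "D \<in> sets borel"
    by (rule sets.countable[rotated]) simp
  \<comment> \<open>There are countably many shared targets: those that are not atoms carry no
    \<nu>-mass together, and the others are covered by \<open>S_atom\<close>.\<close>
  have "C - D \<in> null_sets \<nu>"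
  proof -
    have "(\<Union>y\<in>C - D. {y}) \<in> null_sets \<nu>"
      using C by (intro null_sets_UN') (auto simp: D_def null_sets_def \<nu>(1) \<nu>.emeasure_eq_measure not_less measure_le_0_iff)
    then show ?thesis by simp
  qed
  then have "AE y in \<nu>. y \<notin> C - D"
    by (rule AE_not_in)
  then have CD: "AE z in \<pi>. snd z \<in> C \<longrightarrow> snd z \<in> D"
    unfolding d(2)[symmetric] by (auto dest!: AE_distrD[rotated])
  have prob1: "measure \<pi> {z. P z} = 1" if "Measurable.pred \<pi> P" "AE z in \<pi>. P z" for P
    using that by (subst prob_eq_1) (auto simp: pred_def space_eq)
  have S: "S_rg f = {z. f (snd z) = fst z}" "S_diag = {z. snd z = fst z}" "S_atom \<nu> = {z. snd z \<in> D}" for f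
    by (auto simp: S_rg_def S_diag_def S_atom_def D_def)
  have part1: "measure \<pi> (S_rg h \<union> S_diag \<union> S_atom \<nu>) = 1"
    unfolding S Collect_disj_eq[symmetric]
  proof (rule prob1)
    show "AE z in \<pi>. (h (snd z) = fst z \<or> snd z = fst z) \<or> snd z \<in> D"
      using diag graph CD by eventually_elim blast
  qed measurable
  have part2: "\<exists>h\<in>borel_measurable borel. measure \<pi> (S_rg h \<union> S_atom \<nu>) = 1 \<and>
      (AE z in \<pi>. h (snd z) = fst z \<or> snd z \<in> D)"
    if half: "AE x in \<mu>. RN_deriv (plus_measure \<mu> \<nu>) \<mu> x \<ge> 1 / 2"
  proof -
    define T where "T = {x. RN_deriv (plus_measure \<mu> \<nu>) \<mu> x \<ge> 1 / 2}"
    \<comment> \<open>The density bound holds only \<mu>-almost everywhere, and \<nu> may charge the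
      part of \<open>A\<close> outside \<open>T\<close>; hence the marginals are compared on the
      intersection.\<close>
    define B where "B = A \<inter> T"
    have [measurable]: "RN_deriv (plus_measure \<mu> \<nu>) \<mu> \<in> borel_measurable borel"
      using borel_measurable_RN_deriv[of "plus_measure \<mu> \<nu>" \<mu>] \<mu>(1) by (simp cong: measurable_cong_sets)
    have "{x \<in> space borel. RN_deriv (plus_measure \<mu> \<nu>) \<mu> x \<ge> 1 / 2} \<in> sets borel"
      by measurable
    then have B [measurable]: "B \<in> sets borel"
      unfolding B_def T_def using A by simp
    have "emeasure \<nu> B \<le> emeasure \<mu> B"
      by (rule emeasure_le_of_RN_deriv_ge_half)
        (use \<mu> \<nu> B in \<open>auto simp: B_def T_def \<mu>.finite_measure_axioms \<nu>.finite_measure_axioms\<close>)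
    then have off: "AE z in \<pi>. snd z \<in> B \<longrightarrow> fst z \<in> B"
      using diag by (intro AE_source_of_diagonal_target B) (auto simp: d B_def)
    have T: "AE z in \<pi>. fst z \<in> T"
    proof -
      have "AE x in distr \<pi> borel fst. x \<in> T"
        unfolding d T_def mem_Collect_eq by (rule half)
      then show ?thesis
        by (rule AE_distrD[OF measurable_fst_\<pi>])
    qed
    \<comment> \<open>By \<open>off\<close> a target in \<open>B\<close> has its source in
      \<open>B\<close>, and such sources stay put, so the identity is right there. A source in
      \<open>A\<close> lies in \<open>B\<close> by \<open>T\<close>; one outside \<open>A\<close>
      has, by \<open>off\<close>, its target outside \<open>B\<close>, where \<open>h\<close>
      applies.\<close>
    define f where "f y = (if y \<in> B then y else h y)" for y
    have f [measurable]: "f \<in> borel_measurable borel"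
      unfolding f_def by (rule measurable_If_set) (use B in auto)
    have AEf: "AE z in \<pi>. f (snd z) = fst z \<or> snd z \<in> D"
      using diag graph CD off T
    proof eventually_elim
      case (elim z)
      then show ?case
        unfolding f_def B_def by (cases "fst z \<in> A") auto
    qed
    have "measure \<pi> (S_rg f \<union> S_atom \<nu>) = 1"
      unfolding S Collect_disj_eq[symmetric] by (rule prob1[OF _ AEf]) measurable
    with f AEf show ?thesis by blast
  qed
  have monge: "\<pi> \<in> monge_martingale_transports \<mu> \<nu>"
    if [measurable]: "f \<in> borel_measurable borel" and AEf: "AE z in \<pi>. f (snd z) = fst z \<or> snd z \<in> D"
      and atomless: "\<forall>y. measure \<nu> {y} = 0" for f
  proof -
    \<comment> \<open>Without atoms \<open>D\<close> is empty, so \<open>f\<close> recovers the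
      source from the target almost everywhere.\<close>
    have "distr \<nu> borel (\<lambda>y. (f y, y)) = distr \<pi> borel (\<lambda>z. (f (snd z), snd z))"
      unfolding d(2)[symmetric] by (subst distr_distr) (auto simp: comp_def)
    also have "\<dots> = distr \<pi> borel (\<lambda>z. z)"
    proof (rule distr_cong_AE)
      show "AE z in \<pi>. (f (snd z), snd z) = z"
        using AEf atomless by (auto simp: D_def)
      show "(\<lambda>z. (f (snd z), snd z)) \<in> borel_measurable \<pi>"
        by (intro borel_measurable_Pair) measurable
      show "(\<lambda>z. z) \<in> borel_measurable \<pi>"
        by (rule measurable_ident_sets[OF sets_eq])
    qed simp_all
    also have "\<dots> = \<pi>"
      by (rule distr_id2) (simp add: sets_eq)
    finally have "\<pi> = distr \<nu> borel (\<lambda>y. (f y, y))" by (rule sym)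
    with transport show ?thesis
      unfolding monge_martingale_transports_def using that(1) by blast
  qed
  show ?thesis
  proof (intro conjI impI)
    show "\<exists>h\<in>borel_measurable borel. measure \<pi> (S_rg h \<union> S_diag \<union> S_atom \<nu>) = 1"
      by (rule bexI[where x = h]) fact+
  next
    assume half: "AE x in \<mu>. RN_deriv (plus_measure \<mu> \<nu>) \<mu> x \<ge> 1 / 2"
    from part2[OF this] obtain f where f: "f \<in> borel_measurable borel"
      and f': "measure \<pi> (S_rg f \<union> S_atom \<nu>) = 1 \<and> (AE z in \<pi>. f (snd z) = fst z \<or> snd z \<in> D)"
      by (rule bexE)
    show "\<exists>h\<in>borel_measurable borel. measure \<pi> (S_rg h \<union> S_atom \<nu>) = 1"
      by (rule bexI[where x = f]) (rule conjunct1[OF f'], rule f)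
    show "\<pi> \<in> monge_martingale_transports \<mu> \<nu>" if "\<forall>y. measure \<nu> {y} = 0"
      by (rule monge[OF f conjunct2[OF f'] that])
  qed
qed

end
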